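(* Let $m, n \in \{1,2,3,\ldots\} \cup \{\omega\}$ with $m \neq n$. Then the group $mV$ is not isomorphic to the group $nV$.
   Context: Identify the Cantor set $C$ with $\{0,1\}^{\mathbb N}$, the set of infinite binary strings $s = s_0s_1s_2\ldots$ with the product topology. For a finite binary string $P$ and $s \in C$, $Ps$ denotes concatenation. For a positive integer $n$, an $n$-rectangle in $C^n$ is a set of the form $(P_0,\ldots,P_{n-1}) := \{(P_0z_0,\ldots,P_{n-1}z_{n-1}) : z_i \in C\}$ where $P_0,\ldots,P_{n-1}$ are finite binary strings (possibly empty). Given $n$-rectangles $D=(P_0,\ldots,P_{n-1})$ and $R=(Q_0,\ldots,Q_{n-1})$, the $n$-rectangle (prefix) map $\tau_{(D,R)}:D\to R$ sends $(P_0z_0,\ldots,P_{n-1}z_{n-1})\mapsto (Q_0z_0,\ldots,Q_{n-1}z_{n-1})$. A pattern is a partition of $C^n$ into finitely many $n$-rectangles. The group $nV$ (Brin's higher-dimensional Thompson group) is the group of all homeomorphisms $f:C^n\to C^n$ for which there exist an integer $k$, a domain pattern $\{D_1,\dots,D_k\}$ and a range pattern $\{R_1,\dots,R_k\}$ such that $f$ is the union of the $n$-rectangle maps $\tau_{(D_i,R_i)}$, $1\le i\le k$. For $n=\omega$: $C^\omega$ is the countable product of copies of $C$; an $\omega$-rectangle is $(P_0,P_1,P_2,\ldots)$ with only finitely many $P_i$ nonempty, defined analogously; $\omega$-rectangle maps, patterns, and the group $\omega V$ of homeomorphisms of $C^\omega$ are defined in the same way (so $\omega V$ is the direct union of the groups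 $nV$). Note $1V = V$ is R. Thompson's group $V$. *)

theory Defs
  imports "HOL-Analysis.Analysis" "HOL-Algebra.Bij" "HOL-Library.Extended_Nat"
begin

text \<open>Cantor set C = {0,1}^N as (nat => bool) with the product of discrete topologies.
  The dimension d :: enat ranges over 1,2,3,... and \<infinity> (= omega).
  A point of C^d is an extensional function on the index set {i. enat i < d}.\<close>

definition cantor_top :: "(nat \<Rightarrow> bool) topology" where
  "cantor_top = product_topology (\<lambda>_. discrete_topology (UNIV :: bool set)) (UNIV :: nat set)"

definition idx :: "enat \<Rightarrow> nat set" where
  "idx d = {i. enat i < d}"

definition cube_top :: "enat \<Rightarrow> (nat \<Rightarrow> nat \<Rightarrow> bool) topology" where
  "cube_top d = product_topology (\<lambda>_. cantor_top) (idx d)"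

definition cube :: "enat \<Rightarrow> (nat \<Rightarrow> nat \<Rightarrow> bool) set" where
  "cube d = topspace (cube_top d)"

text \<open>A d-rectangle is given by a family of finite binary strings P i (i in idx d),
  only finitely many nonempty, and P i = [] outside idx d (irrelevant entries).\<close>

definition is_rect :: "enat \<Rightarrow> (nat \<Rightarrow> bool list) \<Rightarrow> bool" where
  "is_rect d P \<longleftrightarrow> finite {i. P i \<noteq> []} \<and> (\<forall>i. i \<notin> idx d \<longrightarrow> P i = [])"

definition rect :: "enat \<Rightarrow> (nat \<Rightarrow> bool list) \<Rightarrow> (nat \<Rightarrow> nat \<Rightarrow> bool) set" where
  "rect d P = {x \<in> cube d. \<forall>i \<in> idx d. \<forall>k < length (P i). x i k = P i ! k}"

text \<open>The rectangle map tau_(D,R): (P_i z_i)_i |-> (Q_i z_i)_i.\<close>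

definition rect_map :: "enat \<Rightarrow> (nat \<Rightarrow> bool list) \<Rightarrow> (nat \<Rightarrow> bool list)
    \<Rightarrow> (nat \<Rightarrow> nat \<Rightarrow> bool) \<Rightarrow> (nat \<Rightarrow> nat \<Rightarrow> bool)" where
  "rect_map d P Q x = (\<lambda>i \<in> idx d. (\<lambda>k. if k < length (Q i) then Q i ! k
                                         else x i (k - length (Q i) + length (P i))))"

definition is_pattern :: "enat \<Rightarrow> (nat \<Rightarrow> bool list) list \<Rightarrow> bool" where
  "is_pattern d Ps \<longleftrightarrow> (\<forall>j < length Ps. is_rect d (Ps ! j))
     \<and> (\<forall>j < length Ps. \<forall>l < length Ps. j \<noteq> l \<longrightarrow> rect d (Ps ! j) \<inter> rect d (Ps ! l) = {})
     \<and> (\<Union>j < length Ps. rect d (Ps ! j)) = cube d"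

text \<open>The underlying set of dV (d = \<infinity> gives omega V): homeomorphisms of C^d that are
  a union of rectangle maps between a domain pattern and a range pattern.
  Maps are taken extensional (undefined off C^d) so that they form a group under composition.\<close>

definition dV :: "enat \<Rightarrow> ((nat \<Rightarrow> nat \<Rightarrow> bool) \<Rightarrow> (nat \<Rightarrow> nat \<Rightarrow> bool)) set" where
  "dV d = {f. f \<in> extensional (cube d) \<and> homeomorphic_map (cube_top d) (cube_top d) f \<and>
     (\<exists>Ds Rs. length Ds = length Rs \<and> is_pattern d Ds \<and> is_pattern d Rs \<and>
        (\<forall>j < length Ds. \<forall>x \<in> rect d (Ds ! j). f x = rect_map d (Ds ! j) (Rs ! j) x))}"

definition dV_group :: "enat \<Rightarrow> ((nat \<Rightarrow> nat \<Rightarrow> bool) \<Rightarrow> (nat \<Rightarrow> nat \<Rightarrow> bool)) monoid" where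
  "dV_group d = (BijGroup (cube d)) \<lparr>carrier := dV d\<rparr>"

end

theory Submission
  imports Defs
begin

text \<open>The elements of \<open>dV\<close> are the bijections of \<open>C\<^sup>d\<close> that near every point
  replace prefixes of finitely many coordinates. At a fixed point \<open>x\<close> of \<open>f\<close> the changes in prefix
  length form the shift of \<open>f\<close> at \<open>x\<close>, an additive invariant which vanishes iff \<open>f\<close> is the identity
  near \<open>x\<close>. Hence the group of germs at \<open>x\<close> embeds in \<open>\<int>\<^sup>d\<close>, and at \<open>x = 0\<close> it contains all unit vectors.

  Germs can be recovered from the abstract group, without Rubin's theorem. Supports of involutions are
  clopen (at a fixed point of an involution, twice its shift is zero), and every cylinder occurs
  as a support. Two involutions \<open>s\<close>, \<open>t\<close> have disjoint supports iff they commute and \<open>s\<close>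
  commutes with \<open>h s h\<^sup>-\<^sup>1\<close> for every \<open>h\<close> centralising \<open>s t\<close>. So an isomorphism respects disjointness, hence
  inclusion, of supports of involutions; by compactness it matches the neighbourhood filter of \<open>0 \<in> C\<^sup>n\<close> with
  that of a point \<open>y \<in> C\<^sup>m\<close>, it carries the stabiliser of \<open>0\<close> into that of \<open>y\<close>, and elements whose
  images are trivial near \<open>y\<close> are trivial near \<open>0\<close>. For \<open>m < n\<close> the shifts at \<open>y\<close> of the images of \<open>m + 1\<close>
  elements with independent shifts at \<open>0\<close> satisfy a nontrivial integer relation, a contradiction.\<close>

section \<open>Cylinders and local prefix replacement\<close>

lemma cube_eq: "cube d = extensional (idx d)"
  by (auto simp: cube_def cube_top_def cantor_top_def PiE_def)

lemma topspace_cube_top [simp]: "topspace (cube_top d) = cube d"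
  by (simp add: cube_def)

lemma cube_eqI:
  assumes "x \<in> cube d" "y \<in> cube d" "\<And>i k. i \<in> idx d \<Longrightarrow> x i k = y i k"
  shows "x = y"
  using assms unfolding cube_eq by (intro extensionalityI[of x "idx d" y]) auto

abbreviation fin_supp :: "(nat \<Rightarrow> nat) \<Rightarrow> bool" where
  "fin_supp p \<equiv> finite {i. p i \<noteq> 0}"

lemma fin_supp_plus:
  assumes "fin_supp p" "fin_supp q"
  shows "fin_supp (\<lambda>i. p i + q i)"
  by (rule finite_subset[OF _ finite_UnI[OF assms]]) auto

lemma fin_supp_minus:
  assumes "fin_supp p"
  shows "fin_supp (\<lambda>i. p i - q i)"
  by (rule finite_subset[OF _ assms]) auto

lemma fin_supp_upd:
  assumes "fin_supp p"
  shows "fin_supp (p(j := c))"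
  by (rule finite_subset[OF _ finite.insertI[OF assms, of j]]) auto

text \<open>A rectangle is given here by one of its points and its prefix lengths. Any point of it
  can then serve as centre (\<open>cyl_eq\<close>), and shrinking a neighbourhood amounts to adding
  lengths. It is a basic open set when \<open>p\<close> has finite support.\<close>

definition cyl :: "enat \<Rightarrow> (nat \<Rightarrow> nat \<Rightarrow> bool) \<Rightarrow> (nat \<Rightarrow> nat) \<Rightarrow> (nat \<Rightarrow> nat \<Rightarrow> bool) set" where
  "cyl d x p = {y \<in> cube d. \<forall>i\<in>idx d. \<forall>k<p i. y i k = x i k}"

lemma cyl_subset_cube: "cyl d x p \<subseteq> cube d"
  by (auto simp: cyl_def)

lemma cyl_self: "x \<in> cube d \<Longrightarrow> x \<in> cyl d x p"
  by (auto simp: cyl_def)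

lemma cylD: "y \<in> cyl d x p \<Longrightarrow> i \<in> idx d \<Longrightarrow> k < p i \<Longrightarrow> y i k = x i k"
  by (simp add: cyl_def)

lemma cyl_mono: "(\<And>i. i \<in> idx d \<Longrightarrow> p i \<le> q i) \<Longrightarrow> cyl d x q \<subseteq> cyl d x p"
  by (fastforce simp: cyl_def)

lemma cyl_eq: "y \<in> cyl d x p \<Longrightarrow> cyl d y p = cyl d x p"
  by (auto simp: cyl_def)

lemma openin_coordinate:
  assumes "i \<in> idx d"
  shows "openin (cube_top d) {y \<in> cube d. y i k = b}"
proof -
  have 1: "continuous_map (cube_top d) cantor_top (\<lambda>y. y i)"
    unfolding cube_top_def by (rule continuous_map_product_projection[OF assms])
  have 2: "continuous_map cantor_top (discrete_topology (UNIV :: bool set)) (\<lambda>z. z k)"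
    unfolding cantor_top_def by (rule continuous_map_product_projection) simp
  have "continuous_map (cube_top d) (discrete_topology UNIV) (\<lambda>y. y i k)"
    using continuous_map_compose[OF 1 2] by (simp add: o_def)
  from openin_continuous_map_preimage[OF this, of "{b}"] show ?thesis by simp
qed

text \<open>A finite intersection of conditions on single letters, one for each pair
  \<open>(i, k)\<close> with \<open>k < p i\<close>. The empty family is treated apart, since its
  intersection is not the cube but the universal set.\<close>

lemma openin_cyl:
  assumes "fin_supp p"
  shows "openin (cube_top d) (cyl d x p)"
proof -
  define J where "J = (SIGMA i:{i \<in> idx d. p i \<noteq> 0}. {k. k < p i})"
  have fin: "finite J"
    unfolding J_def using assms by (intro finite_SigmaI) (auto intro: finite_subset)
  have eq: "cyl d x p = cube d \<inter> (\<Inter>(i,k)\<in>J. {y \<in> cube d. y i k = x i k})"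
    by (auto simp: cyl_def J_def)
  have c: "openin (cube_top d) (cube d)" using openin_topspace[of "cube_top d"] by simp
  show ?thesis
  proof (cases "J = {}")
    case True
    then show ?thesis using eq c by simp
  next
    case False
    have "openin (cube_top d) (\<Inter>(i,k)\<in>J. {y \<in> cube d. y i k = x i k})"
      by (rule openin_Inter) (use fin False in \<open>auto intro!: openin_coordinate simp: J_def\<close>)
    then show ?thesis unfolding eq using c by blast
  qed
qed

lemma compact_cube_top: "compact_space (cube_top d)"
  unfolding cube_top_def cantor_top_def
  by (simp add: compact_space_product_topology compact_space_discrete_topology)

lemma finite_cyl_cover:
  assumes "\<And>x. x \<in> cube d \<Longrightarrow> fin_supp (p x)"
  shows "\<exists>F. finite F \<and> F \<subseteq> cube d \<and> cube d = (\<Union>x\<in>F. cyl d x (p x))"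
proof -
  let ?U = "(\<lambda>x. cyl d x (p x)) ` cube d"
  have "\<forall>U\<in>?U. openin (cube_top d) U" using assms openin_cyl by blast
  moreover have "topspace (cube_top d) \<subseteq> \<Union>?U" using cyl_self by fastforce
  ultimately obtain F where F: "finite F" "F \<subseteq> ?U" "topspace (cube_top d) \<subseteq> \<Union>F"
    using compact_cube_top[of d] unfolding compact_space_alt by meson
  then obtain S where "finite S" "S \<subseteq> cube d" "F = (\<lambda>x. cyl d x (p x)) ` S"
    by (meson finite_subset_image)
  then show ?thesis using F(3) by (intro exI[of _ S]) (auto simp: cyl_def)
qed

text \<open>Near \<open>x\<close>, the map \<open>f\<close> replaces a prefix of length \<open>p i\<close> of the \<open>i\<close>-th coordinate by one of
  length \<open>q i\<close>.\<close>

definition prefix_at :: "enat \<Rightarrow> ((nat \<Rightarrow> nat \<Rightarrow> bool) \<Rightarrow> (nat \<Rightarrow> nat \<Rightarrow> bool)) \<Rightarrow> (nat \<Rightarrow> nat \<Rightarrow> bool)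
    \<Rightarrow> (nat \<Rightarrow> nat) \<Rightarrow> (nat \<Rightarrow> nat) \<Rightarrow> bool" where
  "prefix_at d f x p q \<longleftrightarrow> fin_supp p \<and> fin_supp q \<and>
     (\<forall>y\<in>cyl d x p. \<forall>i\<in>idx d. \<forall>k. f y i k = (if k < q i then f x i k else y i (k - q i + p i)))"

section \<open>Calculus of prefix replacements\<close>

lemma prefix_atD:
  "prefix_at d f x p q \<Longrightarrow> y \<in> cyl d x p \<Longrightarrow> i \<in> idx d \<Longrightarrow>
     f y i k = (if k < q i then f x i k else y i (k - q i + p i))"
  unfolding prefix_at_def by blast

text \<open>The \<open>c i\<close> letters after the prefix are copied unchanged, so they may be
  counted as part of both prefixes. This is how two prefix descriptions are brought to a common
  length.\<close>

lemma prefix_at_extend: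
  assumes f: "prefix_at d f x p q" and c: "fin_supp c" and x: "x \<in> cube d"
  shows "prefix_at d f x (\<lambda>i. p i + c i) (\<lambda>i. q i + c i)"
  unfolding prefix_at_def
proof (intro conjI ballI allI)
  show "fin_supp (\<lambda>i. p i + c i)" "fin_supp (\<lambda>i. q i + c i)"
    using f c by (auto simp: prefix_at_def intro!: fin_supp_plus)
  fix y i k assume y: "y \<in> cyl d x (\<lambda>i. p i + c i)" and i: "i \<in> idx d"
  have y': "y \<in> cyl d x p" using y cyl_mono[of d p "\<lambda>i. p i + c i" x] by auto
  have fx: "f x i k = (if k < q i then f x i k else x i (k - q i + p i))"
    by (rule prefix_atD[OF f cyl_self[OF x] i])
  \<comment> \<open>For \<open>q i \<le> k < q i + c i\<close> the letter of \<open>f y\<close>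
    comes from a position below \<open>p i + c i\<close>, where \<open>y\<close> and
    \<open>x\<close> agree.\<close>
  have *: "y i j = x i j" if "j < p i + c i" for j using y i that by (auto simp: cyl_def)
  have 3: "k - q i + p i = k - (q i + c i) + (p i + c i)" if "\<not> k < q i + c i" using that by simp
  show "f y i k = (if k < q i + c i then f x i k else y i (k - (q i + c i) + (p i + c i)))"
    using prefix_atD[OF f y' i, of k] fx * [of "k - q i + p i"] 3
    by (cases "k < q i"; cases "k < q i + c i") auto
qed

lemma prefix_at_cyl:
  assumes f: "prefix_at d f x p q" and y: "y \<in> cyl d x p"
  shows "prefix_at d f y p q"
  unfolding prefix_at_def cyl_eq[OF y]
  using f prefix_atD[OF f] y by (auto simp: prefix_at_def)

lemma prefix_at_maps_cyl:
  assumes "prefix_at d f x p q" "y \<in> cyl d x p" "f y \<in> cube d"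
  shows "f y \<in> cyl d (f x) q"
  using assms prefix_atD[OF assms(1,2)] by (auto simp: cyl_def)

text \<open>The output lengths of \<open>g\<close> are the input lengths of \<open>f\<close>, so
  \<open>g\<close> carries the whole cylinder into the one on which \<open>f\<close> is
  described.\<close>

lemma prefix_at_compose:
  assumes g: "prefix_at d g x p q" and f: "prefix_at d f (g x) q r"
    and x: "x \<in> cube d" and gS: "g \<in> cube d \<rightarrow> cube d"
  shows "prefix_at d (compose (cube d) f g) x p r"
  unfolding prefix_at_def
proof (intro conjI ballI allI)
  show "fin_supp p" "fin_supp r" using f g by (auto simp: prefix_at_def)
  fix y i k assume y: "y \<in> cyl d x p" and i: "i \<in> idx d"
  have yc: "y \<in> cube d" using y by (simp add: cyl_def)
  have gy: "g y \<in> cyl d (g x) q" using prefix_at_maps_cyl[OF g y] gS yc by blast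
  show "compose (cube d) f g y i k =
      (if k < r i then compose (cube d) f g x i k else y i (k - r i + p i))"
    using prefix_atD[OF f gy i, of k] prefix_atD[OF g y i, of "k - r i + q i"] yc x
    by (auto simp: compose_eq)
qed

lemma prefix_at_inv:
  assumes f: "prefix_at d f x p q" and F: "f \<in> Bij (cube d)" and x: "x \<in> cube d"
  shows "prefix_at d (restrict (inv_into (cube d) f) (cube d)) (f x) q p"
  unfolding prefix_at_def
proof (intro conjI ballI allI)
  show "fin_supp p" "fin_supp q" using f by (auto simp: prefix_at_def)
  have inj: "inj_on f (cube d)" and fS: "\<And>z. z \<in> cube d \<Longrightarrow> f z \<in> cube d"
    using F by (auto simp: Bij_def bij_betw_def)
  fix y i k assume y: "y \<in> cyl d (f x) q" and i: "i \<in> idx d"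
  \<comment> \<open>The preimage of \<open>y\<close>: strip the first \<open>q i\<close> letters of
    \<open>y\<close> and put the first \<open>p i\<close> letters of \<open>x\<close> in their
    place.\<close>
  define z where "z = (\<lambda>i\<in>idx d. \<lambda>k. if k < p i then x i k else y i (k - p i + q i))"
  have z: "z \<in> cyl d x p" by (auto simp: z_def cyl_def cube_eq)
  have zc: "z \<in> cube d" using z by (simp add: cyl_def)
  have yc: "y \<in> cube d" using y by (simp add: cyl_def)
  have "f z = y"
  proof (rule cube_eqI[OF fS[OF zc] yc])
    fix i k assume i: "i \<in> idx d"
    show "f z i k = y i k"
      using prefix_atD[OF f z i, of k] y i by (auto simp: z_def cyl_def)
  qed
  then have "inv_into (cube d) f y = z" using inv_into_f_f[OF inj zc] by simp
  moreover have "inv_into (cube d) f (f x) = x" using inv_into_f_f[OF inj x] by simp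
  ultimately show "restrict (inv_into (cube d) f) (cube d) y i k =
      (if k < p i then restrict (inv_into (cube d) f) (cube d) (f x) i k else y i (k - p i + q i))"
    using i yc fS[OF x] by (simp add: z_def)
qed

section \<open>Local prefix maps as homeomorphisms\<close>

definition locally_prefix :: "enat \<Rightarrow> ((nat \<Rightarrow> nat \<Rightarrow> bool) \<Rightarrow> (nat \<Rightarrow> nat \<Rightarrow> bool)) \<Rightarrow> bool" where
  "locally_prefix d f \<longleftrightarrow> (\<forall>x\<in>cube d. \<exists>p q. prefix_at d f x p q)"

lemma locally_prefix_inv:
  assumes "locally_prefix d f" "f \<in> Bij (cube d)"
  shows "locally_prefix d (restrict (inv_into (cube d) f) (cube d))"
  unfolding locally_prefix_def
proof
  fix y assume "y \<in> cube d"
  then obtain x where x: "x \<in> cube d" "y = f x" using assms(2) by (auto simp: Bij_def bij_betw_def)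
  then show "\<exists>p q. prefix_at d (restrict (inv_into (cube d) f) (cube d)) y p q"
    using assms prefix_at_inv unfolding locally_prefix_def by metis
qed

text \<open>Counting \<open>p' i\<close> further letters makes the output prefix at least
  \<open>p' i\<close> long, so the image agrees with \<open>f x\<close> that far. This is continuity
  in terms of cylinders.\<close>

lemma prefix_at_continuous:
  assumes f: "prefix_at d f x p q" and x: "x \<in> cube d" and p': "fin_supp p'"
    and fS: "f \<in> cube d \<rightarrow> cube d"
  obtains r where "fin_supp r" "f ` cyl d x r \<subseteq> cyl d (f x) p'"
proof
  let ?r = "\<lambda>i. p i + p' i"
  have r: "prefix_at d f x ?r (\<lambda>i. q i + p' i)" using f p' x by (rule prefix_at_extend)
  show "fin_supp ?r" using r by (simp add: prefix_at_def)
  show "f ` cyl d x ?r \<subseteq> cyl d (f x) p'"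
  proof
    fix w assume "w \<in> f ` cyl d x ?r"
    then obtain y where y: "y \<in> cyl d x ?r" "w = f y" by blast
    have "f y \<in> cyl d (f x) (\<lambda>i. q i + p' i)"
      using prefix_at_maps_cyl[OF r y(1)] fS y(1) cyl_subset_cube by blast
    then show "w \<in> cyl d (f x) p'" using cyl_mono[of d p' "\<lambda>i. q i + p' i"] y(2) by auto
  qed
qed

lemma locally_prefix_continuous:
  assumes lp: "locally_prefix d f" and F: "f \<in> Bij (cube d)"
  shows "continuous_map (cube_top d) (cube_top d) f"
proof -
  have fS: "f \<in> cube d \<rightarrow> cube d" using F by (rule Bij_imp_funcset)
  have "continuous_map (cube_top d) (discrete_topology (UNIV::bool set)) (\<lambda>x. f x i k)"
    if i: "i \<in> idx d" for i k
    unfolding continuous_map_def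
  proof (intro conjI allI impI)
    show "(\<lambda>x. f x i k) \<in> topspace (cube_top d) \<rightarrow> topspace (discrete_topology UNIV)" by simp
    fix U :: "bool set"
    show "openin (cube_top d) {x \<in> topspace (cube_top d). f x i k \<in> U}"
    proof (subst openin_subopen, intro ballI)
      fix x assume "x \<in> {x \<in> topspace (cube_top d). f x i k \<in> U}"
      then have x: "x \<in> cube d" and xU: "f x i k \<in> U" by auto
      obtain p q where pq: "prefix_at d f x p q" using lp x unfolding locally_prefix_def by blast
      \<comment> \<open>The cylinder with these lengths fixes letters 0 to \<open>k\<close> of
        coordinate \<open>i\<close>, enough to freeze letter \<open>k\<close> of the image.\<close>
      have "fin_supp ((\<lambda>_. 0)(i := Suc k))" by (rule fin_supp_upd) simp
      from prefix_at_continuous[OF pq x this fS] obtain r where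
        r: "fin_supp r" "f ` cyl d x r \<subseteq> cyl d (f x) ((\<lambda>_. 0)(i := Suc k))" .
      have "cyl d x r \<subseteq> {x \<in> topspace (cube_top d). f x i k \<in> U}"
      proof
        fix y assume y: "y \<in> cyl d x r"
        then have "f y \<in> cyl d (f x) ((\<lambda>_. 0)(i := Suc k))" using r by blast
        then have "f y i k = f x i k" using i by (auto simp: cyl_def)
        then show "y \<in> {x \<in> topspace (cube_top d). f x i k \<in> U}" using y xU by (auto simp: cyl_def)
      qed
      then show "\<exists>T. openin (cube_top d) T \<and> x \<in> T \<and> T \<subseteq> {x \<in> topspace (cube_top d). f x i k \<in> U}"
        using openin_cyl[OF r(1), of d x] cyl_self[OF x, of r] by (intro exI[of _ "cyl d x r"]) simp
    qed
  qed
  then have "continuous_map (cube_top d) cantor_top (\<lambda>x. f x i)" if "i \<in> idx d" for i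
    unfolding cantor_top_def continuous_map_componentwise_UNIV using that by blast
  moreover have "f ` topspace (cube_top d) \<subseteq> extensional (idx d)" using fS cube_eq by auto
  ultimately show ?thesis
    unfolding cube_top_def[of d, symmetric] continuous_map_componentwise[of "cube_top d" "\<lambda>_. cantor_top" "idx d", folded cube_top_def]
    by blast
qed

lemma locally_prefix_homeomorphic:
  assumes lp: "locally_prefix d f" and F: "f \<in> Bij (cube d)"
  shows "homeomorphic_map (cube_top d) (cube_top d) f"
proof -
  let ?g = "restrict (inv_into (cube d) f) (cube d)"
  have "continuous_map (cube_top d) (cube_top d) ?g"
    by (rule locally_prefix_continuous[OF locally_prefix_inv[OF lp F] restrict_inv_into_Bij[OF F]])
  moreover have "inj_on f (cube d)" "f ` cube d = cube d" using F by (auto simp: Bij_def bij_betw_def)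
  ultimately have "homeomorphic_maps (cube_top d) (cube_top d) f ?g"
    using locally_prefix_continuous[OF lp F]
    by (auto simp: homeomorphic_maps_def f_inv_into_f)
  then show ?thesis using homeomorphic_map_maps by blast
qed

section \<open>Agreement with the description by patterns\<close>

lemma cyl_rect:
  assumes "x \<in> rect d P"
  shows "cyl d x (\<lambda>i. length (P i)) = rect d P"
  using assms by (auto simp: cyl_def rect_def)

lemma rect_map_prefix_at:
  assumes P: "is_rect d P" and Q: "is_rect d Q" and x: "x \<in> rect d P"
    and f: "\<And>y. y \<in> rect d P \<Longrightarrow> f y = rect_map d P Q y"
  shows "prefix_at d f x (\<lambda>i. length (P i)) (\<lambda>i. length (Q i))"
  using P Q f x unfolding prefix_at_def cyl_rect[OF x]
  by (auto simp: is_rect_def rect_map_def)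

lemma dV_locally_prefix:
  assumes "f \<in> dV d"
  shows "f \<in> Bij (cube d)" "locally_prefix d f"
proof -
  have "homeomorphic_map (cube_top d) (cube_top d) f" "f \<in> extensional (cube d)"
    using assms by (auto simp: dV_def)
  then show "f \<in> Bij (cube d)"
    by (auto simp: Bij_def bij_betw_def homeomorphic_eq_everything_map)
  obtain Ds Rs where l: "length Ds = length Rs" and D: "is_pattern d Ds" and R: "is_pattern d Rs"
    and f: "\<forall>j<length Ds. \<forall>x\<in>rect d (Ds ! j). f x = rect_map d (Ds ! j) (Rs ! j) x"
    using assms by (auto simp: dV_def)
  show "locally_prefix d f"
    unfolding locally_prefix_def
  proof
    fix x assume "x \<in> cube d"
    then obtain j where j: "j < length Ds" "x \<in> rect d (Ds ! j)"
      using D unfolding is_pattern_def by blast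
    then have "prefix_at d f x (\<lambda>i. length ((Ds ! j) i)) (\<lambda>i. length ((Rs ! j) i))"
      using l D R f by (intro rect_map_prefix_at) (auto simp: is_pattern_def)
    then show "\<exists>p q. prefix_at d f x p q" by blast
  qed
qed

text \<open>Compactness replaces the lengths chosen point by point by one system \<open>u\<close>.
  It vanishes off \<open>idx d\<close> so that it can give the string lengths of rectangles.\<close>

lemma locally_prefix_uniform:
  assumes lp: "locally_prefix d f"
  obtains u where "fin_supp u" "\<And>i. i \<notin> idx d \<Longrightarrow> u i = 0"
    "\<And>x. x \<in> cube d \<Longrightarrow> \<exists>q. prefix_at d f x u q"
proof -
  have "\<forall>x\<in>cube d. \<exists>p. \<exists>q. prefix_at d f x p q" using lp unfolding locally_prefix_def by blast
  then obtain p where p: "\<And>x. x \<in> cube d \<Longrightarrow> \<exists>q. prefix_at d f x (p x) q" by metis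
  have fs: "fin_supp (p x)" if "x \<in> cube d" for x using p[OF that] by (auto simp: prefix_at_def)
  from finite_cyl_cover[of d p, OF fs] obtain F where
    F: "finite F" "F \<subseteq> cube d" "cube d = (\<Union>x\<in>F. cyl d x (p x))" by auto
  \<comment> \<open>The sum over the finite cover dominates every \<open>p x\<close> on
    \<open>idx d\<close> and keeps finite support; the missing letters are supplied by
    \<open>prefix_at_extend\<close>.\<close>
  define u where "u = (\<lambda>i. if i \<in> idx d then \<Sum>x\<in>F. p x i else 0)"
  have u: "fin_supp u"
  proof (rule finite_subset)
    show "{i. u i \<noteq> 0} \<subseteq> (\<Union>x\<in>F. {i. p x i \<noteq> 0})"
      unfolding u_def by (auto simp del: neq0_conv sum_eq_0_iff split: if_splits
          elim!: sum.not_neutral_contains_not_neutral)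
    show "finite (\<Union>x\<in>F. {i. p x i \<noteq> 0})" using F fs by auto
  qed
  show ?thesis
  proof
    show "fin_supp u" by (rule u)
    show "u i = 0" if "i \<notin> idx d" for i using that by (simp add: u_def)
    fix y assume y: "y \<in> cube d"
    then obtain x where x: "x \<in> F" "y \<in> cyl d x (p x)" using F by blast
    obtain q where q: "prefix_at d f x (p x) q" using p x F by blast
    have le: "p x i \<le> u i" if "i \<in> idx d" for i
      unfolding u_def using that F(1) x(1) by (auto intro: member_le_sum)
    have "prefix_at d f y (p x) q" using q x(2) by (rule prefix_at_cyl)
    from prefix_at_extend[OF this fin_supp_minus[OF u, of "p x"] y]
    have pr: "prefix_at d f y (\<lambda>i. p x i + (u i - p x i)) (\<lambda>i. q i + (u i - p x i))" .
    have *: "i \<in> idx d \<Longrightarrow> p x i + (u i - p x i) = u i" for i using le by simp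
    have "cyl d y (\<lambda>i. p x i + (u i - p x i)) = cyl d y u"
      using * by (simp add: cyl_def)
    then have "prefix_at d f y u (\<lambda>i. q i + (u i - p x i))"
      using pr u * by (simp add: prefix_at_def)
    then show "\<exists>q. prefix_at d f y u q" by blast
  qed
qed

lemma rect_nonempty:
  "\<exists>x. x \<in> rect d P"
  by (rule exI[of _ "\<lambda>i\<in>idx d. \<lambda>k. P i ! k"]) (auto simp: rect_def cube_eq)

text \<open>Cut the cube into all rectangles with the uniform lengths \<open>u\<close>. On each of
  them \<open>f\<close> is a single rectangle map, and bijectivity of \<open>f\<close> turns the
  images into a pattern.\<close>

lemma locally_prefix_dV:
  assumes F: "f \<in> Bij (cube d)" and lp: "locally_prefix d f"
  shows "f \<in> dV d"
proof -
  have fS: "f \<in> cube d \<rightarrow> cube d" using F by (rule Bij_imp_funcset)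
  have inj: "inj_on f (cube d)" and im: "f ` cube d = cube d" using F by (auto simp: Bij_def bij_betw_def)
  obtain u where u: "fin_supp u" "\<And>i. i \<notin> idx d \<Longrightarrow> u i = 0"
    "\<And>x. x \<in> cube d \<Longrightarrow> \<exists>q. prefix_at d f x u q"
    using locally_prefix_uniform[OF lp] by blast
  then obtain q where q: "\<And>x. x \<in> cube d \<Longrightarrow> prefix_at d f x u (q x)" by metis
  \<comment> \<open>This set is finite because only finitely many \<open>u i\<close> are nonzero and
    there are finitely many strings of each length.\<close>
  define A where "A = {P :: nat \<Rightarrow> bool list. \<forall>i. length (P i) = u i}"
  have finA: "finite A"
  proof (rule finite_subset)
    let ?L = "\<Union>i\<in>{i. u i \<noteq> 0}. {l :: bool list. length l = u i}"
    have "finite {l :: bool list. length l = n}" for n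
      using finite_lists_length_eq[of "UNIV :: bool set" n] by simp
    then have "finite ?L" using u(1) by auto
    then show "finite {P. \<forall>i. (i \<in> {i. u i \<noteq> 0} \<longrightarrow> P i \<in> ?L) \<and> (i \<notin> {i. u i \<noteq> 0} \<longrightarrow> P i = [])}"
      by (rule finite_set_of_finite_funs[OF u(1)])
    show "A \<subseteq> {P. \<forall>i. (i \<in> {i. u i \<noteq> 0} \<longrightarrow> P i \<in> ?L) \<and> (i \<notin> {i. u i \<noteq> 0} \<longrightarrow> P i = [])}"
      unfolding A_def by (auto, metis length_0_conv)
  qed
  then obtain Ds where Ds: "set Ds = A" "distinct Ds" using finite_distinct_list by blast
  define pt where "pt P = (SOME x. x \<in> rect d P)" for P
  have pt: "pt P \<in> rect d P" for P unfolding pt_def using rect_nonempty by (rule someI_ex)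
  have ptc: "pt P \<in> cube d" for P using pt[of P] by (simp add: rect_def)
  \<comment> \<open>The target strings are initial segments of the image of a sample point; images
    of all points of the rectangle begin with the same letters.\<close>
  define R where "R P = (\<lambda>i. if i \<in> idx d then map (f (pt P) i) [0..<q (pt P) i] else [])" for P
  have len: "length (P i) = u i" if "P \<in> A" for P i using that by (simp add: A_def)
  have rectA: "is_rect d P" if "P \<in> A" for P
  proof -
    have "{i. P i \<noteq> []} = {i. u i \<noteq> 0}" using len[OF that] by (metis length_0_conv)
    moreover have "P i = []" if "i \<notin> idx d" for i using len[OF \<open>P \<in> A\<close>, of i] u(2)[OF that] by simp
    ultimately show ?thesis using u(1) by (simp add: is_rect_def)
  qed
  have cylA: "cyl d (pt P) u = rect d P" if "P \<in> A" for P
    using cyl_rect[OF pt[of P]] len[OF that] by simp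
  have rectR: "is_rect d (R P)" for P
  proof -
    have "fin_supp (q (pt P))" using q[OF ptc] by (simp add: prefix_at_def)
    then have "finite {i. R P i \<noteq> []}"
      by (rule rev_finite_subset) (auto simp: R_def)
    then show ?thesis by (simp add: is_rect_def R_def)
  qed
  have map: "f x = rect_map d P (R P) x" if "P \<in> A" "x \<in> rect d P" for P x
  proof (rule cube_eqI)
    have x: "x \<in> cube d" using that by (simp add: rect_def)
    show "f x \<in> cube d" using x fS by blast
    show "rect_map d P (R P) x \<in> cube d" by (simp add: rect_map_def cube_eq)
    fix i k assume i: "i \<in> idx d"
    have "x \<in> cyl d (pt P) u" using cylA that by simp
    from prefix_atD[OF q[OF ptc] this i, of k]
    show "f x i k = rect_map d P (R P) x i k" using i len[OF that(1), of i]
      by (simp add: rect_map_def R_def)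
  qed
  have imR: "f ` rect d P = rect d (R P)" if "P \<in> A" for P
  proof (intro equalityI subsetI)
    fix w assume "w \<in> f ` rect d P"
    then obtain x where x: "x \<in> rect d P" "w = f x" by blast
    then have "w \<in> cube d" using fS by (auto simp: rect_def)
    then show "w \<in> rect d (R P)" using map[OF that x(1)] x(2) by (auto simp: rect_def rect_map_def)
  next
    fix w assume w: "w \<in> rect d (R P)"
    define z where "z = (\<lambda>i\<in>idx d. \<lambda>k. if k < length (P i) then P i ! k
      else w i (k - length (P i) + length (R P i)))"
    have z: "z \<in> rect d P" by (auto simp: z_def rect_def cube_eq)
    have "f z = w"
    proof (rule cube_eqI)
      show "f z \<in> cube d" using z fS by (auto simp: rect_def)
      show "w \<in> cube d" using w by (simp add: rect_def)
      fix i k assume i: "i \<in> idx d"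
      show "f z i k = w i k"
        using map[OF that z] i w by (auto simp: rect_map_def z_def rect_def)
    qed
    then show "w \<in> f ` rect d P" using z by blast
  qed
  have disjA: "rect d P \<inter> rect d Q = {}" if PQ: "P \<in> A" "Q \<in> A" "P \<noteq> Q" for P Q
  proof -
    obtain i where i: "P i \<noteq> Q i" using PQ(3) by blast
    then have "u i \<noteq> 0" using len[OF PQ(1), of i] len[OF PQ(2), of i] by (metis length_0_conv)
    then have "i \<in> idx d" using u(2)[of i] by auto
    moreover have "\<exists>k<u i. P i ! k \<noteq> Q i ! k"
      using i len[OF PQ(1), of i] len[OF PQ(2), of i] by (auto simp: list_eq_iff_nth_eq)
    ultimately show ?thesis
      using len[OF PQ(1), of i] len[OF PQ(2), of i] by (auto simp: rect_def)
  qed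
  have coverA: "(\<Union>P\<in>A. rect d P) = cube d"
  proof (intro equalityI subsetI)
    fix x assume x: "x \<in> cube d"
    have "(\<lambda>i. map (x i) [0..<u i]) \<in> A" by (simp add: A_def)
    moreover have "x \<in> rect d (\<lambda>i. map (x i) [0..<u i])" using x by (simp add: rect_def)
    ultimately show "x \<in> (\<Union>P\<in>A. rect d P)" by blast
  qed (auto simp: rect_def)
  have nthA: "Ds ! j \<in> A" if "j < length Ds" for j using that Ds nth_mem by blast
  have UnA: "(\<Union>j<length Ds. h (Ds ! j)) = (\<Union>P\<in>A. h P)" for h :: "(nat \<Rightarrow> bool list) \<Rightarrow> (nat \<Rightarrow> nat \<Rightarrow> bool) set"
    unfolding Ds(1)[symmetric] by (force simp: in_set_conv_nth)
  have pD: "is_pattern d Ds"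
    unfolding is_pattern_def using rectA nthA disjA Ds(2) coverA UnA[of "rect d"]
    by (simp add: nth_eq_iff_index_eq)
  have "is_pattern d (map R Ds)"
    unfolding is_pattern_def
  proof (intro conjI allI impI)
    show "is_rect d (map R Ds ! j)" if "j < length (map R Ds)" for j using that rectR by simp
    show "rect d (map R Ds ! j) \<inter> rect d (map R Ds ! l) = {}"
      if "j < length (map R Ds)" "l < length (map R Ds)" "j \<noteq> l" for j l
    proof -
      have jl: "j < length Ds" "l < length Ds" using that by auto
      have "rect d (Ds ! j) \<inter> rect d (Ds ! l) = {}"
        using pD that unfolding is_pattern_def by simp
      moreover have "rect d (Ds ! j) \<subseteq> cube d" "rect d (Ds ! l) \<subseteq> cube d" by (auto simp: rect_def)
      ultimately have "f ` rect d (Ds ! j) \<inter> f ` rect d (Ds ! l) = {}"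
        using inj_on_image_Int[OF inj] by (metis image_empty)
      then show ?thesis using imR nthA jl by simp
    qed
    have "(\<Union>j<length (map R Ds). rect d (map R Ds ! j)) = (\<Union>j<length Ds. f ` rect d (Ds ! j))"
      using imR nthA by simp
    also have "\<dots> = f ` (\<Union>P\<in>A. rect d P)" using UnA[of "\<lambda>P. f ` rect d P"] by (simp add: image_UN)
    finally show "(\<Union>j<length (map R Ds). rect d (map R Ds ! j)) = cube d"
      using coverA im by simp
  qed
  then have "length Ds = length (map R Ds) \<and> is_pattern d Ds \<and> is_pattern d (map R Ds) \<and>
      (\<forall>j<length Ds. \<forall>x\<in>rect d (Ds ! j). f x = rect_map d (Ds ! j) (map R Ds ! j) x)"
    using pD map nthA by simp
  then show ?thesis
    using F locally_prefix_homeomorphic[OF lp F] unfolding dV_def Bij_def by blast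
qed

lemma dV_iff: "f \<in> dV d \<longleftrightarrow> f \<in> Bij (cube d) \<and> locally_prefix d f"
  using dV_locally_prefix locally_prefix_dV by blast

section \<open>The group and its germs\<close>

lemma subgroup_dV: "subgroup (dV d) (BijGroup (cube d))"
proof -
  interpret B: group "BijGroup (cube d)" by (rule group_BijGroup)
  show ?thesis
  proof (rule B.subgroupI)
    show "dV d \<subseteq> carrier (BijGroup (cube d))" by (auto simp: dV_iff BijGroup_def)
    have "prefix_at d (\<lambda>x\<in>cube d. x) x (\<lambda>_. 0) (\<lambda>_. 0)" if "x \<in> cube d" for x
      using that by (auto simp: prefix_at_def cyl_def)
    then have "(\<lambda>x\<in>cube d. x) \<in> dV d" by (auto simp: dV_iff locally_prefix_def id_Bij)
    then show "dV d \<noteq> {}" by blast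
    show "inv\<^bsub>BijGroup (cube d)\<^esub> f \<in> dV d" if "f \<in> dV d" for f
      using that locally_prefix_inv restrict_inv_into_Bij by (auto simp: dV_iff inv_BijGroup)
    show "f \<otimes>\<^bsub>BijGroup (cube d)\<^esub> g \<in> dV d" if "f \<in> dV d" "g \<in> dV d" for f g
    proof -
      have f: "f \<in> Bij (cube d)" "locally_prefix d f" and g: "g \<in> Bij (cube d)" "locally_prefix d g"
        using that by (auto simp: dV_iff)
      have gS: "g \<in> cube d \<rightarrow> cube d" using g(1) by (rule Bij_imp_funcset)
      have "\<exists>p q. prefix_at d (compose (cube d) f g) x p q" if x: "x \<in> cube d" for x
      proof -
        obtain p q where g': "prefix_at d g x p q" using g(2) x unfolding locally_prefix_def by blast
        obtain p' q' where f': "prefix_at d f (g x) p' q'"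
          using f(2) gS x unfolding locally_prefix_def by blast
        \<comment> \<open>With truncated subtraction, \<open>q i + (p' i - q i)\<close> and
          \<open>p' i + (q i - p' i)\<close> are both the maximum of \<open>q i\<close> and
          \<open>p' i\<close>: the common length at which \<open>g\<close> ends and \<open>f\<close>
          starts.\<close>
        have fs: "fin_supp (\<lambda>i. p' i - q i)" "fin_supp (\<lambda>i. q i - p' i)"
          using f' g' fin_supp_minus by (auto simp: prefix_at_def)
        have "prefix_at d g x (\<lambda>i. p i + (p' i - q i)) (\<lambda>i. q i + (p' i - q i))"
          using g' fs(1) x by (rule prefix_at_extend)
        moreover have "prefix_at d f (g x) (\<lambda>i. p' i + (q i - p' i)) (\<lambda>i. q' i + (q i - p' i))"
          using f' fs(2) by (rule prefix_at_extend) (use gS x in blast)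
        moreover have "(\<lambda>i. p' i + (q i - p' i)) = (\<lambda>i. q i + (p' i - q i))" by auto
        ultimately show ?thesis using prefix_at_compose[OF _ _ x gS] by metis
      qed
      then show ?thesis
        using f g compose_Bij by (simp add: dV_iff BijGroup_def locally_prefix_def)
    qed
  qed
qed

interpretation dV: group "dV_group d" for d
  unfolding dV_group_def using subgroup_dV group_BijGroup by (rule subgroup.subgroup_is_group)

lemma carrier_dV [simp]: "carrier (dV_group d) = dV d"
  by (simp add: dV_group_def)

lemma dV_mult_closed [simp]: "f \<in> dV d \<Longrightarrow> g \<in> dV d \<Longrightarrow> f \<otimes>\<^bsub>dV_group d\<^esub> g \<in> dV d"
  using dV.m_closed[of f d g] by simp

lemma dV_inv_closed [simp]: "f \<in> dV d \<Longrightarrow> inv\<^bsub>dV_group d\<^esub> f \<in> dV d"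
  using dV.inv_closed[of f d] by simp

lemma dV_one_closed [simp]: "\<one>\<^bsub>dV_group d\<^esub> \<in> dV d"
  using dV.one_closed[of d] by simp

lemma dV_maps [simp]: "f \<in> dV d \<Longrightarrow> x \<in> cube d \<Longrightarrow> f x \<in> cube d"
  using Bij_imp_funcset by (fastforce simp: dV_iff)

lemma dV_mult: "f \<in> dV d \<Longrightarrow> g \<in> dV d \<Longrightarrow> f \<otimes>\<^bsub>dV_group d\<^esub> g = compose (cube d) f g"
  by (simp add: dV_group_def BijGroup_def dV_iff)

lemma dV_mult_apply [simp]:
  "f \<in> dV d \<Longrightarrow> g \<in> dV d \<Longrightarrow> x \<in> cube d \<Longrightarrow> (f \<otimes>\<^bsub>dV_group d\<^esub> g) x = f (g x)"
  by (simp add: dV_mult compose_eq)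

lemma dV_one_apply [simp]: "x \<in> cube d \<Longrightarrow> \<one>\<^bsub>dV_group d\<^esub> x = x"
  by (simp add: dV_group_def BijGroup_def)

lemma dV_inv_apply [simp]:
  assumes "f \<in> dV d" "x \<in> cube d"
  shows "f ((inv\<^bsub>dV_group d\<^esub> f) x) = x" "(inv\<^bsub>dV_group d\<^esub> f) (f x) = x"
proof -
  have "f \<otimes>\<^bsub>dV_group d\<^esub> inv\<^bsub>dV_group d\<^esub> f = \<one>\<^bsub>dV_group d\<^esub>"
    "inv\<^bsub>dV_group d\<^esub> f \<otimes>\<^bsub>dV_group d\<^esub> f = \<one>\<^bsub>dV_group d\<^esub>"
    using assms by simp_all
  then show "f ((inv\<^bsub>dV_group d\<^esub> f) x) = x" "(inv\<^bsub>dV_group d\<^esub> f) (f x) = x"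
    using dV_mult_apply[of f d "inv\<^bsub>dV_group d\<^esub> f" x] dV_mult_apply[of "inv\<^bsub>dV_group d\<^esub> f" d f x] assms
    by (metis dV_inv_closed dV_one_apply)+
qed

lemma dV_inj: "f \<in> dV d \<Longrightarrow> x \<in> cube d \<Longrightarrow> y \<in> cube d \<Longrightarrow> f x = f y \<longleftrightarrow> x = y"
  by (metis dV_inv_apply(2))

lemma dV_eq_iff:
  assumes "f \<in> dV d" "g \<in> dV d"
  shows "f = g \<longleftrightarrow> (\<forall>x\<in>cube d. f x = g x)"
proof -
  have "f \<in> extensional (cube d)" "g \<in> extensional (cube d)" using assms by (auto simp: dV_def)
  then show ?thesis using extensionalityI by blast
qed

lemma dV_prefix_at:
  assumes "f \<in> dV d" "x \<in> cube d"
  obtains p q where "prefix_at d f x p q"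
  using assms by (auto simp: dV_iff locally_prefix_def)

lemma dV_I:
  assumes ext: "f \<in> extensional (cube d)" and fS: "\<And>x. x \<in> cube d \<Longrightarrow> f x \<in> cube d"
    and gS: "\<And>x. x \<in> cube d \<Longrightarrow> g x \<in> cube d"
    and gf: "\<And>x. x \<in> cube d \<Longrightarrow> g (f x) = x" and fg: "\<And>x. x \<in> cube d \<Longrightarrow> f (g x) = x"
    and pre: "\<And>x. x \<in> cube d \<Longrightarrow> \<exists>p q. prefix_at d f x p q"
  shows "f \<in> dV d"
proof -
  have "bij_betw f (cube d) (cube d)"
    by (rule bij_betw_byWitness[where f' = g]) (use fS gS gf fg in auto)
  then show ?thesis using ext pre by (auto simp: dV_iff locally_prefix_def Bij_def)
qed

section \<open>Supports, and shifts at fixed points\<close>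

definition supp :: "enat \<Rightarrow> ((nat \<Rightarrow> nat \<Rightarrow> bool) \<Rightarrow> (nat \<Rightarrow> nat \<Rightarrow> bool)) \<Rightarrow> (nat \<Rightarrow> nat \<Rightarrow> bool) set" where
  "supp d f = {x \<in> cube d. f x \<noteq> x}"

lemma supp_subset_cube: "supp d f \<subseteq> cube d"
  by (auto simp: supp_def)

lemma supp_maps: "f \<in> dV d \<Longrightarrow> x \<in> supp d f \<Longrightarrow> f x \<in> supp d f"
  by (auto simp: supp_def dV_inj)

lemma maps_of_supp_subset:
  assumes "f \<in> dV d" "supp d f \<subseteq> A" "x \<in> A" "A \<subseteq> cube d"
  shows "f x \<in> A"
proof (cases "x \<in> supp d f")
  case True
  then show ?thesis using supp_maps assms by blast
next
  case False
  then show ?thesis using assms by (auto simp: supp_def)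
qed

lemma supp_conj:
  assumes "f \<in> dV d" "h \<in> dV d"
  shows "supp d (h \<otimes>\<^bsub>dV_group d\<^esub> f \<otimes>\<^bsub>dV_group d\<^esub> inv\<^bsub>dV_group d\<^esub> h) = h ` supp d f"
proof (intro equalityI subsetI)
  let ?hi = "inv\<^bsub>dV_group d\<^esub> h"
  fix x assume "x \<in> supp d (h \<otimes>\<^bsub>dV_group d\<^esub> f \<otimes>\<^bsub>dV_group d\<^esub> ?hi)"
  then have "x \<in> cube d" "h (f (?hi x)) \<noteq> x" using assms by (auto simp: supp_def)
  then have "?hi x \<in> supp d f" "x = h (?hi x)" using assms by (auto simp: supp_def)
  then show "x \<in> h ` supp d f" by blast
qed (use assms in \<open>auto simp: supp_def dV_inj\<close>)

lemma dV_continuous: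
  assumes "f \<in> dV d" "x \<in> cube d" "fin_supp p'"
  obtains r where "fin_supp r" "f ` cyl d x r \<subseteq> cyl d (f x) p'"
proof -
  obtain p q where "prefix_at d f x p q" using assms dV_prefix_at by blast
  from prefix_at_continuous[OF this assms(2,3)] assms(1) that show ?thesis by (auto simp: Pi_def)
qed

text \<open>Separation by a single letter: for points near \<open>x\<close>, letter \<open>k\<close>
  of coordinate \<open>i\<close> of the image is that of \<open>f x\<close>, whereas throughout the
  cylinder it is the different letter of \<open>x\<close>.\<close>

lemma supp_displaced:
  assumes f: "f \<in> dV d" and x: "x \<in> supp d f"
  obtains p where "fin_supp p" "\<And>y. y \<in> cyl d x p \<Longrightarrow> f y \<notin> cyl d x p"
proof -
  have xc: "x \<in> cube d" using x by (simp add: supp_def)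
  have "\<exists>i\<in>idx d. \<exists>k. f x i k \<noteq> x i k"
    using cube_eqI[of "f x" d x] x f by (auto simp: supp_def)
  then obtain i k where i: "i \<in> idx d" and k: "f x i k \<noteq> x i k" by blast
  have p0: "fin_supp ((\<lambda>_. 0)(i := Suc k))" by (rule fin_supp_upd) simp
  obtain r where r: "fin_supp r" "f ` cyl d x r \<subseteq> cyl d (f x) ((\<lambda>_. 0)(i := Suc k))"
    using dV_continuous[OF f xc p0] .
  let ?p = "\<lambda>j. r j + ((\<lambda>_. 0)(i := Suc k)) j"
  show ?thesis
  proof
    show "fin_supp ?p" by (rule fin_supp_plus[OF r(1) p0])
    fix y assume y: "y \<in> cyl d x ?p"
    have "y \<in> cyl d x r" using cyl_mono[of d r ?p x] y by auto
    then have "f y \<in> cyl d (f x) ((\<lambda>_. 0)(i := Suc k))" using r by blast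
    then have "f y i k = f x i k" using cylD[OF _ i, of "f y" "f x" _ k] by simp
    then show "f y \<notin> cyl d x ?p" using cylD[OF _ i, of "f y" x ?p k] k by auto
  qed
qed

lemma supp_open:
  assumes f: "f \<in> dV d" and x: "x \<in> supp d f"
  obtains p where "fin_supp p" "cyl d x p \<subseteq> supp d f"
proof -
  obtain p where "fin_supp p" "\<And>y. y \<in> cyl d x p \<Longrightarrow> f y \<notin> cyl d x p"
    using supp_displaced[OF f x] by blast
  then show ?thesis using that[of p] cyl_subset_cube by (fastforce simp: supp_def)
qed

text \<open>The shift counts the binary contraction of each coordinate at a fixed point. It is a
  relation because the lengths \<open>p\<close> and \<open>q\<close> describing a germ can be
  enlarged together; their difference is what matters.\<close>

definition has_shift :: "enat \<Rightarrow> ((nat \<Rightarrow> nat \<Rightarrow> bool) \<Rightarrow> (nat \<Rightarrow> nat \<Rightarrow> bool)) \<Rightarrow> (nat \<Rightarrow> nat \<Rightarrow> bool)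
    \<Rightarrow> (nat \<Rightarrow> int) \<Rightarrow> bool" where
  "has_shift d f x v \<longleftrightarrow> f \<in> dV d \<and> x \<in> cube d \<and> f x = x \<and>
     (\<exists>p q. prefix_at d f x p q \<and> (\<forall>i\<in>idx d. v i = int (q i) - int (p i)))"

lemma has_shift_ex:
  assumes "f \<in> dV d" "x \<in> cube d" "f x = x"
  shows "\<exists>v. has_shift d f x v"
proof -
  obtain p q where "prefix_at d f x p q" using assms dV_prefix_at by blast
  then show ?thesis
    using assms by (intro exI[of _ "\<lambda>i. int (q i) - int (p i)"]) (auto simp: has_shift_def)
qed

lemma has_shift_mult:
  assumes "has_shift d f x v" "has_shift d g x w"
  shows "has_shift d (f \<otimes>\<^bsub>dV_group d\<^esub> g) x (\<lambda>i. v i + w i)"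
proof -
  have f: "f \<in> dV d" "f x = x" and g: "g \<in> dV d" "g x = x" and x: "x \<in> cube d"
    using assms by (auto simp: has_shift_def)
  obtain p q where g': "prefix_at d g x p q" "\<And>i. i \<in> idx d \<Longrightarrow> w i = int (q i) - int (p i)"
    using assms(2) by (auto simp: has_shift_def)
  obtain p' q' where f': "prefix_at d f x p' q'" "\<And>i. i \<in> idx d \<Longrightarrow> v i = int (q' i) - int (p' i)"
    using assms(1) by (auto simp: has_shift_def)
  have fs: "fin_supp p'" "fin_supp q"
    using f' g' by (auto simp: prefix_at_def)
  \<comment> \<open>The two descriptions are lengthened crosswise, \<open>g\<close> by
    \<open>p'\<close> and \<open>f\<close> by \<open>q\<close>, to meet at
    \<open>q i + p' i\<close>.\<close>
  have 1: "prefix_at d g x (\<lambda>i. p i + p' i) (\<lambda>i. q i + p' i)"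
    using g'(1) fs(1) x by (rule prefix_at_extend)
  have 2: "prefix_at d f (g x) (\<lambda>i. q i + p' i) (\<lambda>i. q' i + q i)"
    using prefix_at_extend[OF f'(1) fs(2) x] g(2) by (simp add: add.commute)
  have "prefix_at d (f \<otimes>\<^bsub>dV_group d\<^esub> g) x (\<lambda>i. p i + p' i) (\<lambda>i. q' i + q i)"
    unfolding dV_mult[OF f(1) g(1)]
    by (rule prefix_at_compose[OF 1 2 x]) (use g in auto)
  then show ?thesis
    using f g x f'(2) g'(2) unfolding has_shift_def
    by (intro conjI exI[of _ "\<lambda>i. p i + p' i"] exI[of _ "\<lambda>i. q' i + q i"]) auto
qed

lemma has_shift_inv:
  assumes "has_shift d f x v"
  shows "has_shift d (inv\<^bsub>dV_group d\<^esub> f) x (\<lambda>i. - v i)"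
proof -
  have f: "f \<in> dV d" "f x = x" and x: "x \<in> cube d"
    using assms by (auto simp: has_shift_def)
  obtain p q where f': "prefix_at d f x p q" "\<And>i. i \<in> idx d \<Longrightarrow> v i = int (q i) - int (p i)"
    using assms by (auto simp: has_shift_def)
  have F: "f \<in> Bij (cube d)" using f by (simp add: dV_iff)
  have "inv\<^bsub>dV_group d\<^esub> f = restrict (inv_into (cube d) f) (cube d)"
    unfolding dV_group_def
    by (subst group.m_inv_consistent[OF group_BijGroup subgroup_dV f(1)]) (rule inv_BijGroup[OF F])
  then have "prefix_at d (inv\<^bsub>dV_group d\<^esub> f) x q p" using prefix_at_inv[OF f'(1) F x] f(2) by simp
  moreover have "(inv\<^bsub>dV_group d\<^esub> f) x = x" using dV_inv_apply(2)[OF f(1) x] f(2) by simp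
  ultimately show ?thesis using f x f'(2) unfolding has_shift_def
    by (intro conjI exI[of _ q] exI[of _ p]) auto
qed

text \<open>Equal lengths before and after, together with \<open>f x = x\<close>, mean that the
  prefix is replaced by itself.\<close>

lemma has_shift_zero_trivial:
  assumes "has_shift d f x v" "\<And>i. i \<in> idx d \<Longrightarrow> v i = 0"
  obtains p where "fin_supp p" "\<And>y. y \<in> cyl d x p \<Longrightarrow> f y = y"
proof -
  have f: "f \<in> dV d" "f x = x" and x: "x \<in> cube d"
    using assms by (auto simp: has_shift_def)
  obtain p q where f': "prefix_at d f x p q" "\<And>i. i \<in> idx d \<Longrightarrow> v i = int (q i) - int (p i)"
    using assms by (auto simp: has_shift_def)
  then have eq: "q i = p i" if "i \<in> idx d" for i using assms(2)[OF that] that by simp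
  show ?thesis
  proof
    show "fin_supp p" using f' by (simp add: prefix_at_def)
    fix y assume y: "y \<in> cyl d x p"
    show "f y = y"
    proof (rule cube_eqI)
      show y': "y \<in> cube d" using y by (simp add: cyl_def)
      then show "f y \<in> cube d" using f by simp
      fix i k assume i: "i \<in> idx d"
      show "f y i k = y i k" using prefix_atD[OF f'(1) y i, of k] eq[OF i] f(2) y i
        by (auto simp: cyl_def)
    qed
  qed
qed

text \<open>A nonzero shift moves letters of the tail to other positions. Negating one letter far
  out in \<open>x\<close> exposes this, since \<open>f\<close> would have to fix both the old and
  the new point.\<close>

lemma trivial_has_shift_zero:
  assumes v: "has_shift d f x v" and r: "fin_supp r" "\<And>y. y \<in> cyl d x r \<Longrightarrow> f y = y" and i: "i \<in> idx d"
  shows "v i = 0"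
proof (rule ccontr)
  assume ne: "v i \<noteq> 0"
  have f: "f \<in> dV d" "f x = x" and x: "x \<in> cube d"
    using v by (auto simp: has_shift_def)
  obtain p q where f': "prefix_at d f x p q" "\<And>i. i \<in> idx d \<Longrightarrow> v i = int (q i) - int (p i)"
    using v by (auto simp: has_shift_def)
  define P where "P = p i + r i"
  define Q where "Q = q i + r i"
  have PQ: "P \<noteq> Q" using ne f'(2)[OF i] by (auto simp: P_def Q_def)
  have f2: "prefix_at d f x (\<lambda>i. p i + r i) (\<lambda>i. q i + r i)"
    using f'(1) r(1) x by (rule prefix_at_extend)
  \<comment> \<open>As \<open>k\<close> is at least \<open>P\<close>, changing letter
    \<open>k\<close> does not leave the cylinder; as it is at least \<open>Q\<close>, letter
    \<open>k\<close> of the image is read from the tail.\<close>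
  define k where "k = max P Q"
  define y where "y = x(i := (x i)(k := \<not> x i k))"
  have y: "y \<in> cyl d x (\<lambda>i. p i + r i)"
    using x i by (auto simp: cyl_def y_def cube_eq extensional_def k_def P_def)
  have yr: "y \<in> cyl d x r" using y cyl_mono[of d r "\<lambda>i. p i + r i" x] by auto
  have "y i k = y i (k - Q + P)"
    using prefix_atD[OF f2 y i, of k] r(2)[OF yr] by (simp add: k_def P_def Q_def)
  moreover have "x i k = x i (k - Q + P)"
    using prefix_atD[OF f2 cyl_self[OF x] i, of k] f(2) by (simp add: k_def P_def Q_def)
  moreover have "k - Q + P \<noteq> k" using PQ by (auto simp: k_def)
  ultimately show False by (auto simp: y_def)
qed

section \<open>Disjointness of supports\<close>

definition involution :: "('a, 'b) monoid_scheme \<Rightarrow> 'a \<Rightarrow> bool" where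
  "involution G s \<longleftrightarrow> s \<in> carrier G \<and> s \<noteq> \<one>\<^bsub>G\<^esub> \<and> s \<otimes>\<^bsub>G\<^esub> s = \<one>\<^bsub>G\<^esub>"

lemma involution_dV: "involution (dV_group d) s \<Longrightarrow> s \<in> dV d"
  by (simp add: involution_def)

lemma involution_apply: "involution (dV_group d) s \<Longrightarrow> x \<in> cube d \<Longrightarrow> s (s x) = x"
  using dV_mult_apply[of s d s x] by (simp add: involution_def)

lemma involution_supp_nonempty: "involution (dV_group d) s \<Longrightarrow> supp d s \<noteq> {}"
  using dV_eq_iff[of s d "\<one>\<^bsub>dV_group d\<^esub>"] by (auto simp: involution_def supp_def)

text \<open>The shift of \<open>s\<close> at a fixed point, doubled, is a shift of a map trivial
  near that point. So it is zero and \<open>s\<close> is trivial nearby.\<close>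

lemma involution_supp_closed:
  assumes s: "s \<in> dV d" "\<And>y. y \<in> cube d \<Longrightarrow> s (s y) = y" and x: "x \<in> cube d" "x \<notin> supp d s"
  obtains p where "fin_supp p" "cyl d x p \<inter> supp d s = {}"
proof -
  have sx: "s x = x" using x by (simp add: supp_def)
  obtain v where v: "has_shift d s x v" using has_shift_ex[OF s(1) x(1) sx] by blast
  have "v i = 0" if "i \<in> idx d" for i
  proof -
    have "v i + v i = 0"
      by (rule trivial_has_shift_zero[OF has_shift_mult[OF v v], of "\<lambda>_. 0"])
        (use that s in \<open>auto simp: cyl_def\<close>)
    then show ?thesis by simp
  qed
  then obtain p where p: "fin_supp p" "\<And>y. y \<in> cyl d x p \<Longrightarrow> s y = y"
    using has_shift_zero_trivial[OF v] by blast
  then have "cyl d x p \<inter> supp d s = {}" by (auto simp: supp_def)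
  with p(1) show ?thesis by (rule that)
qed

text \<open>Only group operations occur, so every isomorphism respects the relation.\<close>

definition alg_disjoint :: "('a, 'b) monoid_scheme \<Rightarrow> 'a \<Rightarrow> 'a \<Rightarrow> bool" where
  "alg_disjoint G s t \<longleftrightarrow> s \<otimes>\<^bsub>G\<^esub> t = t \<otimes>\<^bsub>G\<^esub> s \<and>
     (\<forall>h\<in>carrier G. h \<otimes>\<^bsub>G\<^esub> (s \<otimes>\<^bsub>G\<^esub> t) = (s \<otimes>\<^bsub>G\<^esub> t) \<otimes>\<^bsub>G\<^esub> h \<longrightarrow>
        s \<otimes>\<^bsub>G\<^esub> (h \<otimes>\<^bsub>G\<^esub> s \<otimes>\<^bsub>G\<^esub> inv\<^bsub>G\<^esub> h) = (h \<otimes>\<^bsub>G\<^esub> s \<otimes>\<^bsub>G\<^esub> inv\<^bsub>G\<^esub> h) \<otimes>\<^bsub>G\<^esub> s)"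

lemma iso_involution:
  assumes "group G" "group H" "\<phi> \<in> iso G H" "s \<in> carrier G"
  shows "involution H (\<phi> s) \<longleftrightarrow> involution G s"
proof -
  interpret group_hom G H \<phi> using assms by (simp add: group_hom_def group_hom_axioms_def iso_def)
  have inj: "inj_on \<phi> (carrier G)" using assms(3) by (auto simp: iso_def bij_betw_def)
  show ?thesis
    using assms(4) inj_on_eq_iff[OF inj, of s "\<one>\<^bsub>G\<^esub>"] inj_on_eq_iff[OF inj, of "s \<otimes>\<^bsub>G\<^esub> s" "\<one>\<^bsub>G\<^esub>"]
    by (simp add: involution_def)
qed

lemma iso_alg_disjoint:
  assumes "group G" "group H" "\<phi> \<in> iso G H" "s \<in> carrier G" "t \<in> carrier G"
  shows "alg_disjoint H (\<phi> s) (\<phi> t) \<longleftrightarrow> alg_disjoint G s t"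
proof -
  interpret group_hom G H \<phi> using assms by (simp add: group_hom_def group_hom_axioms_def iso_def)
  have inj: "inj_on \<phi> (carrier G)" and im: "carrier H = \<phi> ` carrier G"
    using assms(3) by (auto simp: iso_def bij_betw_def)
  have eq: "\<phi> a = \<phi> b \<longleftrightarrow> a = b" if "a \<in> carrier G" "b \<in> carrier G" for a b
    using inj_on_eq_iff[OF inj that] .
  show ?thesis
    unfolding alg_disjoint_def im ball_simps
    using assms(4,5) by (simp add: eq hom_mult[symmetric] hom_inv[symmetric] del: hom_mult hom_inv)
qed

section \<open>Elements supported in a cylinder\<close>

lemma zero_in_idx: "d \<ge> 1 \<Longrightarrow> 0 \<in> idx d"
  unfolding idx_def by (cases d) (auto simp: one_enat_def zero_enat_def)

text \<open>On the cylinder, the first free letter of coordinate 0 is negated. Coordinate 0 exists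
  in every dimension at least 1, so each cylinder with finitely supported lengths becomes the
  support of an involution.\<close>

definition flip :: "enat \<Rightarrow> (nat \<Rightarrow> nat \<Rightarrow> bool) \<Rightarrow> (nat \<Rightarrow> nat) \<Rightarrow> (nat \<Rightarrow> nat \<Rightarrow> bool) \<Rightarrow> nat \<Rightarrow> nat \<Rightarrow> bool" where
  "flip d x p = (\<lambda>y\<in>cube d. if y \<in> cyl d x p then y(0 := (y 0)(p 0 := \<not> y 0 (p 0))) else y)"

lemma flip_involution:
  assumes d: "d \<ge> 1" and p: "fin_supp p" and x: "x \<in> cube d"
  shows "involution (dV_group d) (flip d x p)" "supp d (flip d x p) = cyl d x p"
proof -
  have 0: "0 \<in> idx d" using d by (rule zero_in_idx)
  have mem: "flip d x p y \<in> cube d" if "y \<in> cube d" for y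
    using that 0 by (auto simp: flip_def cube_eq extensional_def)
  have memc: "flip d x p y \<in> cyl d x p \<longleftrightarrow> y \<in> cyl d x p" if "y \<in> cube d" for y
    using that 0 mem[OF that] by (auto simp: flip_def cyl_def)
  have inv: "flip d x p (flip d x p y) = y" if "y \<in> cube d" for y
    using that mem[OF that] memc[OF that] by (auto simp: flip_def)
  have pre: "\<exists>p' q'. prefix_at d (flip d x p) y p' q'" if y: "y \<in> cube d" for y
  proof (intro exI)
    \<comment> \<open>One letter more than \<open>p\<close>, so that the negated letter belongs to
      the prefix.\<close>
    let ?P = "p(0 := Suc (p 0))"
    have P: "fin_supp ?P" using p by (rule fin_supp_upd)
    show "prefix_at d (flip d x p) y ?P ?P"
      unfolding prefix_at_def
    proof (intro conjI ballI allI P)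
      fix z i k assume z: "z \<in> cyl d y ?P" and i: "i \<in> idx d"
      have "cyl d y ?P \<subseteq> cyl d y p" by (rule cyl_mono) auto
      then have zp: "z \<in> cyl d y p" using z by blast
      have zc: "z \<in> cube d" using z by (simp add: cyl_def)
      have iff: "z \<in> cyl d x p \<longleftrightarrow> y \<in> cyl d x p"
        using cyl_eq cyl_eq[OF zp] cyl_self y zc by metis
      show "flip d x p z i k = (if k < ?P i then flip d x p y i k else z i (k - ?P i + ?P i))"
        using y zc iff cylD[OF z i, of k] by (auto simp: flip_def)
    qed
  qed
  have dV: "flip d x p \<in> dV d"
    by (rule dV_I[where g = "flip d x p"])
      (use mem inv pre in \<open>auto simp: flip_def[abs_def]\<close>)
  show supp: "supp d (flip d x p) = cyl d x p"
  proof (intro equalityI subsetI)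
    fix y assume y: "y \<in> cyl d x p"
    then have "y \<in> cube d" using cyl_subset_cube by blast
    moreover have "flip d x p y 0 (p 0) \<noteq> y 0 (p 0)" using y \<open>y \<in> cube d\<close> by (simp add: flip_def)
    ultimately show "y \<in> supp d (flip d x p)" by (auto simp: supp_def)
  qed (auto simp: supp_def flip_def split: if_splits)
  have "flip d x p \<otimes>\<^bsub>dV_group d\<^esub> flip d x p = \<one>\<^bsub>dV_group d\<^esub>"
    using dV inv by (subst dV_eq_iff[of _ d]) auto
  moreover have "flip d x p \<noteq> \<one>\<^bsub>dV_group d\<^esub>"
  proof
    assume eq: "flip d x p = \<one>\<^bsub>dV_group d\<^esub>"
    have "flip d x p x \<noteq> x" using supp cyl_self[OF x, of p] unfolding supp_def by blast
    then show False using dV_one_apply[OF x] unfolding eq by blast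
  qed
  ultimately show "involution (dV_group d) (flip d x p)"
    using dV by (simp add: involution_def)
qed

text \<open>The product of the flips of two nested cylinders permutes the values of the first two
  free letters of coordinate 0 in a cycle of length four.\<close>

lemma ex_noninvolution:
  assumes d: "d \<ge> 1" and p: "fin_supp p" and x: "x \<in> cube d"
  obtains g where "g \<in> dV d" "supp d g \<subseteq> cyl d x p" "g (g x) \<noteq> x"
proof
  let ?p = "p(0 := Suc (p 0))"
  let ?a = "flip d x p" and ?b = "flip d x ?p"
  have fp: "fin_supp ?p" using p by (rule fin_supp_upd)
  have a: "?a \<in> dV d" "supp d ?a = cyl d x p"
    using flip_involution[OF d p x] involution_dV by auto
  have b: "?b \<in> dV d" "supp d ?b = cyl d x ?p"
    by (rule involution_dV, rule flip_involution(1)[OF d fp x]) (rule flip_involution(2)[OF d fp x])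
  have 0: "0 \<in> idx d" using d by (rule zero_in_idx)
  have sub: "cyl d x ?p \<subseteq> cyl d x p" by (rule cyl_mono) auto
  let ?g = "?a \<otimes>\<^bsub>dV_group d\<^esub> ?b"
  show "?g \<in> dV d" using a b by simp
  show "supp d ?g \<subseteq> cyl d x p"
  proof
    fix y assume y: "y \<in> supp d ?g"
    then have yc: "y \<in> cube d" by (simp add: supp_def)
    show "y \<in> cyl d x p"
    proof (rule ccontr)
      assume "y \<notin> cyl d x p"
      then have "?a y = y" "?b y = y" using a(2) b(2) sub yc by (auto simp: supp_def)
      then show False using y yc a b by (simp add: supp_def)
    qed
  qed
  \<comment> \<open>\<open>?x1\<close> is \<open>x\<close> with the second free letter negated,
    \<open>?x2\<close> has both negated. The product sends \<open>x\<close> to \<open>?x2\<close>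
    and \<open>?x2\<close> to \<open>?x1\<close>.\<close>
  let ?x1 = "x(0 := (x 0)(Suc (p 0) := \<not> x 0 (Suc (p 0))))"
  let ?x2 = "?x1(0 := (?x1 0)(p 0 := \<not> x 0 (p 0)))"
  have x1: "?x1 \<in> cyl d x ?p" using x 0 by (auto simp: cyl_def cube_eq extensional_def)
  have x2: "?x2 \<in> cyl d x p" "?x2 \<in> cube d"
    using x 0 by (auto simp: cyl_def cube_eq extensional_def)
  have x2': "?x2 \<notin> cyl d x ?p"
    using cylD[OF _ 0, of ?x2 x ?p "p 0"] by auto
  have x1': "?x1 \<in> cyl d x p" "?x1 \<in> cube d" using x1 sub cyl_subset_cube by blast+
  have 1: "?b x = ?x1" using x cyl_self[OF x, of ?p] by (simp add: flip_def)
  have 2: "?a ?x1 = ?x2" using x1' by (simp add: flip_def)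
  have 3: "?b ?x2 = ?x2" using x2 x2' by (simp add: flip_def)
  have 4: "?a ?x2 = ?x1" using x2 by (auto simp: flip_def fun_eq_iff)
  have "?g x = ?x2" by (simp only: dV_mult_apply[OF a(1) b(1) x] 1 2)
  moreover have "?g ?x2 = ?x1" by (simp only: dV_mult_apply[OF a(1) b(1) x2(2)] 3 4)
  moreover have "?x1 \<noteq> x"
  proof
    assume "?x1 = x"
    then have "?x1 0 (Suc (p 0)) = x 0 (Suc (p 0))" by metis
    then show False by simp
  qed
  ultimately show "?g (?g x) \<noteq> x" by metis
qed

text \<open>Let \<open>u\<close> be the product. Then \<open>s\<close>, and each conjugate of
  \<open>s\<close> by an element centralising \<open>u\<close>, equals \<open>u\<close> on a
  \<open>u\<close>-invariant set and the identity elsewhere. Two maps of this kind commute.\<close>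

lemma disjoint_imp_alg_disjoint:
  assumes s: "involution (dV_group d) s" and t: "involution (dV_group d) t"
    and disj: "supp d s \<inter> supp d t = {}"
  shows "alg_disjoint (dV_group d) s t"
proof -
  have sV: "s \<in> dV d" and tV: "t \<in> dV d" using s t by (auto simp: involution_dV)
  have off: "s x = x" if "x \<in> cube d" "x \<notin> supp d s" for x using that by (auto simp: supp_def)
  have offt: "t x = x" if "x \<in> cube d" "x \<in> supp d s" for x using that disj by (auto simp: supp_def)
  have comm: "s (t x) = t (s x)" if x: "x \<in> cube d" for x
  proof (cases "x \<in> supp d s")
    case True
    then show ?thesis using offt supp_maps[OF sV True] x sV by simp
  next
    case False
    then have "t x \<notin> supp d s" using supp_maps[OF tV] disj x by (cases "x \<in> supp d t") (auto simp: supp_def)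
    then show ?thesis using off False x tV by simp
  qed
  define u where "u = s \<otimes>\<^bsub>dV_group d\<^esub> t"
  have uV: "u \<in> dV d" using sV tV by (simp add: u_def)
  have us: "u x = s x" if "x \<in> supp d s" for x
    using that offt sV tV by (simp add: u_def supp_def)
  have "s (h (s ((inv\<^bsub>dV_group d\<^esub> h) x))) = h (s ((inv\<^bsub>dV_group d\<^esub> h) (s x)))"
    if h: "h \<in> dV d" "\<And>x. x \<in> cube d \<Longrightarrow> h (u x) = u (h x)" and x: "x \<in> cube d" for h x
  proof -
    define k where "k = h \<otimes>\<^bsub>dV_group d\<^esub> s \<otimes>\<^bsub>dV_group d\<^esub> inv\<^bsub>dV_group d\<^esub> h"
    have kV: "k \<in> dV d" using h sV by (simp add: k_def)
    have ka: "k y = h (s ((inv\<^bsub>dV_group d\<^esub> h) y))" if "y \<in> cube d" for y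
      using that h sV by (simp add: k_def)
    have ks: "supp d k = h ` supp d s" unfolding k_def by (rule supp_conj[OF sV h(1)])
    \<comment> \<open>\<open>s\<close> equals \<open>u\<close> on its support and \<open>h\<close>
      commutes with \<open>u\<close>, so the conjugate equals \<open>u\<close> on the
      \<open>h\<close>-image of that support.\<close>
    have ku: "k y = u y" if "y \<in> supp d k" for y
    proof -
      obtain z where z: "z \<in> supp d s" "y = h z" using \<open>y \<in> supp d k\<close> ks by auto
      have zc: "z \<in> cube d" using z by (simp add: supp_def)
      have "k y = h (s z)" using ka z(2) zc h(1) by simp
      also have "\<dots> = u y" using us[OF z(1)] h(2)[OF zc] z(2) by simp
      finally show ?thesis .
    qed
    have koff: "k y = y" if "y \<in> cube d" "y \<notin> supp d k" for y using that by (auto simp: supp_def)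
    have stay: "u y \<in> supp d s \<longleftrightarrow> y \<in> supp d s" if y: "y \<in> cube d" for y
    proof
      assume "y \<in> supp d s" then show "u y \<in> supp d s" using us supp_maps[OF sV] by simp
    next
      assume a: "u y \<in> supp d s"
      show "y \<in> supp d s"
      proof (rule ccontr)
        assume n: "y \<notin> supp d s"
        have "s (t y) = s y" if "t y = y" using that by simp
        then show False
          using a n y off[OF y n] comm[OF y] supp_maps[OF tV, of y] disj tV sV
          by (cases "y \<in> supp d t") (auto simp: u_def supp_def)
      qed
    qed
    have stayk: "u y \<in> supp d k \<longleftrightarrow> y \<in> supp d k" if y: "y \<in> cube d" for y
    proof -
      obtain z where z: "z \<in> cube d" "y = h z" using y h(1) dV_inv_apply(1)[OF h(1) y] by (metis dV_inv_closed dV_maps)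
      have "u y = h (u z)" using h(2) z by simp
      moreover have "h w \<in> h ` supp d s \<longleftrightarrow> w \<in> supp d s" if "w \<in> cube d" for w
        using that h(1) dV_inj[OF h(1)] supp_subset_cube[of d s] by blast
      ultimately show ?thesis unfolding ks using z stay[OF z(1)] uV by simp
    qed
    have xs: "s x \<in> cube d" "k x \<in> cube d" using x sV kV by auto
    \<comment> \<open>On both supports the two maps are \<open>u\<close>; on exactly one, the other
      map fixes the point and its image; on neither, both fix the point.\<close>
    have "s (k x) = k (s x)"
    proof (cases "x \<in> supp d s"; cases "x \<in> supp d k")
      assume a: "x \<in> supp d s" "x \<in> supp d k"
      then show ?thesis using us ku stay[OF x] stayk[OF x] by simp
    next
      assume a: "x \<in> supp d s" "x \<notin> supp d k"
      then show ?thesis using us[OF a(1)] koff[OF x a(2)] koff[OF xs(1)] stayk[OF x] by simp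
    next
      assume a: "x \<notin> supp d s" "x \<in> supp d k"
      then show ?thesis using ku[OF a(2)] off[OF x a(1)] off[OF xs(2)] stay[OF x] by simp
    next
      assume a: "x \<notin> supp d s" "x \<notin> supp d k"
      then show ?thesis using off[OF x a(1)] koff[OF x a(2)] by simp
    qed
    then show ?thesis using ka x xs by simp
  qed
  moreover have "h (u x) = u (h x)"
    if "h \<in> dV d" "h \<otimes>\<^bsub>dV_group d\<^esub> u = u \<otimes>\<^bsub>dV_group d\<^esub> h" "x \<in> cube d" for h x
    using that uV dV_mult_apply[of h d u x] dV_mult_apply[of u d h x] by simp
  moreover have "u = t \<otimes>\<^bsub>dV_group d\<^esub> s"
    unfolding u_def using sV tV comm by (subst dV_eq_iff[of _ d]) auto
  ultimately show ?thesis
    unfolding alg_disjoint_def u_def[symmetric] using sV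
    by (auto simp: dV_eq_iff[of "s \<otimes>\<^bsub>dV_group d\<^esub> _" d])
qed

text \<open>At a common point of the supports, a local element \<open>g\<close> whose square moves a
  point is completed to some \<open>h\<close> that centralises the product but whose conjugate of
  \<open>s\<close> does not commute with \<open>s\<close>.\<close>

lemma alg_disjoint_imp_disjoint:
  assumes d: "d \<ge> 1" and s: "involution (dV_group d) s" and t: "involution (dV_group d) t"
    and st: "alg_disjoint (dV_group d) s t"
  shows "supp d s \<inter> supp d t = {}"
proof (rule ccontr)
  assume "supp d s \<inter> supp d t \<noteq> {}"
  then obtain x where x: "x \<in> supp d s" "x \<in> supp d t" by blast
  have xc: "x \<in> cube d" using x by (simp add: supp_def)
  have sV: "s \<in> dV d" and tV: "t \<in> dV d" using s t by (auto simp: involution_dV)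
  define u where "u = s \<otimes>\<^bsub>dV_group d\<^esub> t"
  have uV: "u \<in> dV d" using sV tV by (simp add: u_def)
  have uc: "u = t \<otimes>\<^bsub>dV_group d\<^esub> s" using st by (simp add: alg_disjoint_def u_def)
  have uts: "u y = t (s y)" "u y = s (t y)" if "y \<in> cube d" for y
    using that sV tV by (simp add: uc) (simp add: that sV tV u_def)
  have ss: "s (s y) = y" "t (t y) = y" if "y \<in> cube d" for y
    using that involution_apply s t by auto
  have uu: "u (u y) = y" if "y \<in> cube d" for y
    using that sV tV uV uts(1)[of y] uts(2)[of "u y"] ss by simp
  \<comment> \<open>Both involutions displace a small cylinder at \<open>x\<close>. Either
    \<open>u\<close> is the identity on it, or shrinking around a point moved by \<open>u\<close>
    gives a cylinder that \<open>u\<close> displaces too.\<close>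
  have "\<exists>a p. a \<in> cube d \<and> fin_supp p \<and> (\<forall>y\<in>cyl d a p. s y \<notin> cyl d a p \<and> t y \<notin> cyl d a p) \<and>
      ((\<forall>y\<in>cyl d a p. u y = y) \<or> (\<forall>y\<in>cyl d a p. u y \<notin> cyl d a p))"
  proof -
    obtain p1 where p1: "fin_supp p1" "\<And>y. y \<in> cyl d x p1 \<Longrightarrow> s y \<notin> cyl d x p1"
      using supp_displaced[OF sV x(1)] by blast
    obtain p2 where p2: "fin_supp p2" "\<And>y. y \<in> cyl d x p2 \<Longrightarrow> t y \<notin> cyl d x p2"
      using supp_displaced[OF tV x(2)] by blast
    define p where "p = (\<lambda>i. p1 i + p2 i)"
    have p: "fin_supp p" unfolding p_def by (rule fin_supp_plus[OF p1(1) p2(1)])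
    have sub: "cyl d x p \<subseteq> cyl d x p1" "cyl d x p \<subseteq> cyl d x p2"
      unfolding p_def by (rule cyl_mono; simp)+
    show ?thesis
    proof (cases "\<forall>y\<in>cyl d x p. u y = y")
      case True
      then show ?thesis using p xc sub p1(2) p2(2) by blast
    next
      case False
      then obtain a where a: "a \<in> cyl d x p" "u a \<noteq> a" by blast
      have ac: "a \<in> cube d" using a by (simp add: cyl_def)
      then have "a \<in> supp d u" using a by (simp add: supp_def)
      then obtain p3 where p3: "fin_supp p3" "\<And>y. y \<in> cyl d a p3 \<Longrightarrow> u y \<notin> cyl d a p3"
        using supp_displaced[OF uV] by blast
      let ?p = "\<lambda>i. p i + p3 i"
      have p': "fin_supp ?p" by (rule fin_supp_plus[OF p p3(1)])
      have sub': "cyl d a ?p \<subseteq> cyl d a p" "cyl d a ?p \<subseteq> cyl d a p3" by (rule cyl_mono; simp)+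
      have A: "cyl d a ?p \<subseteq> cyl d x p" using sub'(1) cyl_eq[OF a(1)] by simp
      have "s y \<notin> cyl d a ?p" if "y \<in> cyl d a ?p" for y using that A sub(1) p1(2)[of y] by blast
      moreover have "t y \<notin> cyl d a ?p" if "y \<in> cyl d a ?p" for y
        using that A sub(2) p2(2)[of y] by blast
      moreover have "u y \<notin> cyl d a ?p" if "y \<in> cyl d a ?p" for y
        using that sub'(2) p3(2)[of y] by blast
      ultimately show ?thesis using p' ac by (intro exI[of _ a] exI[of _ ?p]) simp
    qed
  qed
  then obtain a p where ac: "a \<in> cube d" and p: "fin_supp p"
    and displ: "\<And>y. y \<in> cyl d a p \<Longrightarrow> s y \<notin> cyl d a p" "\<And>y. y \<in> cyl d a p \<Longrightarrow> t y \<notin> cyl d a p"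
    and ucases: "(\<forall>y\<in>cyl d a p. u y = y) \<or> (\<forall>y\<in>cyl d a p. u y \<notin> cyl d a p)" by blast
  define A where "A = cyl d a p"
  have AC: "A \<subseteq> cube d" and aA: "a \<in> A" using cyl_self[OF ac] by (auto simp: A_def cyl_subset_cube)
  obtain g where g: "g \<in> dV d" "supp d g \<subseteq> A" "g (g a) \<noteq> a"
    using ex_noninvolution[OF d p ac] unfolding A_def by blast
  have gA: "g y \<in> A" if "y \<in> A" for y using maps_of_supp_subset[OF g(1,2) that AC] .
  have goff: "g y = y" if "y \<in> cube d" "y \<notin> A" for y using that g(2) by (auto simp: supp_def)
  text \<open>If \<open>h\<close> centralises \<open>u\<close>, agrees with \<open>g\<close> on \<open>A\<close> and fixes \<open>s A\<close>, then \<open>s\<close> and \<open>h s h\<^sup>-\<^sup>1\<close>, applied to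
    \<open>g a\<close> in the two orders, give \<open>a\<close> and \<open>g (g a)\<close>. Take \<open>h = g\<close> or \<open>h = g (u g u)\<close>.\<close>
  have "\<exists>h\<in>dV d. (\<forall>y\<in>cube d. h (u y) = u (h y)) \<and> (\<forall>y\<in>A. h y = g y \<and> h (s y) = s y)"
    using ucases
  proof
    assume uA: "\<forall>y\<in>cyl d a p. u y = y"
    have "g (u y) = u (g y)" if y: "y \<in> cube d" for y
    proof (cases "y \<in> A")
      case True
      then show ?thesis using uA gA by (simp add: A_def)
    next
      case False
      have "u y \<notin> A" using False uA uu[OF y] by (metis A_def)
      then show ?thesis using goff False y uV by simp
    qed
    moreover have "g (s y) = s y" if "y \<in> A" for y
      using goff displ(1) that AC sV by (auto simp: A_def)
    ultimately show ?thesis using g(1) by blast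
  next
    assume uA: "\<forall>y\<in>cyl d a p. u y \<notin> cyl d a p"
    \<comment> \<open>The conjugate of \<open>g\<close> by the involution \<open>u\<close> is
      supported in the \<open>u\<close>-image of \<open>A\<close>, off \<open>A\<close>. So
      \<open>g\<close> and \<open>k\<close> commute and are exchanged by \<open>u\<close>, and their
      product centralises \<open>u\<close>.\<close>
    define k where "k = u \<otimes>\<^bsub>dV_group d\<^esub> g \<otimes>\<^bsub>dV_group d\<^esub> u"
    have kV: "k \<in> dV d" using uV g by (simp add: k_def)
    have k: "k y = u (g (u y))" if "y \<in> cube d" for y using that uV g by (simp add: k_def)
    have kA: "k y = y" if "y \<in> A" for y
      using that uA AC k goff[of "u y"] uu[of y] uV by (auto simp: A_def)
    have comm: "g (k y) = k (g y)" if y: "y \<in> cube d" for y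
    proof (cases "y \<in> A")
      case True
      then show ?thesis using kA gA by simp
    next
      case False
      have "k y \<notin> A"
      proof
        assume "k y \<in> A"
        then have "k (k y) = k y" by (rule kA)
        then have "k y = y" using dV_inj[OF kV] y kV by simp
        then show False using \<open>k y \<in> A\<close> False by simp
      qed
      then show ?thesis using goff False y kV by simp
    qed
    define h where "h = g \<otimes>\<^bsub>dV_group d\<^esub> k"
    have h: "h y = g (k y)" if "y \<in> cube d" for y using that g kV by (simp add: h_def)
    have "h (u y) = u (h y)" if y: "y \<in> cube d" for y
    proof -
      have "h (u y) = g (u (g y))" using h k uu y uV by simp
      moreover have "u (h y) = g (u (g y))"
      proof -
        have "u (h y) = u (k (g y))" using h comm y by simp
        also have "\<dots> = u (u (g (u (g y))))" using k[of "g y"] y g by simp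
        finally show ?thesis using uu[of "g (u (g y))"] y g uV by simp
      qed
      ultimately show ?thesis by simp
    qed
    moreover have "h y = g y" if "y \<in> A" for y using h kA that AC by auto
    moreover have "h (s y) = s y" if y: "y \<in> A" for y
    proof -
      have yc: "y \<in> cube d" using y AC by blast
      \<comment> \<open>Displacement by \<open>t\<close> enters here: \<open>u\<close> sends
        \<open>s y\<close> to \<open>t y\<close>, which is outside \<open>A\<close>, so
        \<open>k\<close> fixes \<open>s y\<close>.\<close>
      have "u (s y) = t y" using uts(1)[of "s y"] ss yc sV by simp
      moreover have "t y \<notin> A" "s y \<notin> A" using displ y by (auto simp: A_def)
      moreover have "u (t y) = s y" using uts(2)[of "t y"] ss yc tV by simp
      ultimately show ?thesis using h k goff yc sV tV by simp
    qed
    moreover have "h \<in> dV d" using g kV by (simp add: h_def)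
    ultimately show ?thesis by blast
  qed
  then obtain h where h: "h \<in> dV d" "\<And>y. y \<in> cube d \<Longrightarrow> h (u y) = u (h y)"
    "\<And>y. y \<in> A \<Longrightarrow> h y = g y" "\<And>y. y \<in> A \<Longrightarrow> h (s y) = s y" by blast
  let ?hi = "inv\<^bsub>dV_group d\<^esub> h"
  let ?k = "h \<otimes>\<^bsub>dV_group d\<^esub> s \<otimes>\<^bsub>dV_group d\<^esub> ?hi"
  have "h \<otimes>\<^bsub>dV_group d\<^esub> u = u \<otimes>\<^bsub>dV_group d\<^esub> h"
    using h uV by (subst dV_eq_iff[of _ d]) auto
  then have eq: "s \<otimes>\<^bsub>dV_group d\<^esub> ?k = ?k \<otimes>\<^bsub>dV_group d\<^esub> s"
    using st h(1) by (auto simp: alg_disjoint_def u_def)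
  have gac: "g a \<in> cube d" "g a \<in> A" using gA aA AC by auto
  have k: "?k z = h (s (?hi z))" if "z \<in> cube d" for z using that h(1) sV by simp
  have kV: "?k \<in> dV d" using h(1) sV by simp
  have "s (?k (g a)) = ?k (s (g a))"
    using arg_cong[OF eq, of "\<lambda>f. f (g a)"] sV kV gac(1) by simp
  moreover have "?hi (g a) = a" using h(3)[OF aA] dV_inv_apply(2)[OF h(1) ac] by simp
  then have "s (?k (g a)) = a" using k[OF gac(1)] h(4)[OF aA] ss ac by simp
  moreover have "?hi (s (g a)) = s (g a)"
    using h(4)[OF gac(2)] dV_inv_apply(2)[OF h(1), of "s (g a)"] gac(1) sV by simp
  then have "?k (s (g a)) = g (g a)" using k[of "s (g a)"] h(3)[OF gac(2)] ss gac(1) sV by simp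
  ultimately show False using g(3) by simp
qed

lemma alg_disjoint_iff:
  assumes "d \<ge> 1" "involution (dV_group d) s" "involution (dV_group d) t"
  shows "alg_disjoint (dV_group d) s t \<longleftrightarrow> supp d s \<inter> supp d t = {}"
  using assms alg_disjoint_imp_disjoint disjoint_imp_alg_disjoint by blast

text \<open>The homeomorphism \<open>0z \<mapsto> 00z\<close>, \<open>10z \<mapsto> 01z\<close>, \<open>11z \<mapsto> 1z\<close> of the Cantor set, and its inverse.\<close>

definition grow_seq :: "(nat \<Rightarrow> bool) \<Rightarrow> nat \<Rightarrow> bool" where
  "grow_seq w = (if \<not> w 0 then case_nat False w
     else if \<not> w 1 then case_nat False (case_nat True (\<lambda>k. w (Suc (Suc k))))
     else (\<lambda>k. w (Suc k)))"

definition ungrow_seq :: "(nat \<Rightarrow> bool) \<Rightarrow> nat \<Rightarrow> bool" where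
  "ungrow_seq w = (if w 0 then case_nat True w
     else if w 1 then case_nat True (case_nat False (\<lambda>k. w (Suc (Suc k))))
     else (\<lambda>k. w (Suc k)))"

lemma ungrow_grow_seq: "ungrow_seq (grow_seq w) = w"
  by (auto simp: ungrow_seq_def grow_seq_def fun_eq_iff split: nat.splits)

lemma grow_ungrow_seq: "grow_seq (ungrow_seq w) = w"
  by (auto simp: ungrow_seq_def grow_seq_def fun_eq_iff split: nat.splits)

section \<open>Elements with unit shift at the zero point\<close>

definition grow :: "enat \<Rightarrow> nat \<Rightarrow> (nat \<Rightarrow> nat \<Rightarrow> bool) \<Rightarrow> nat \<Rightarrow> nat \<Rightarrow> bool" where
  "grow d j = (\<lambda>y\<in>cube d. y(j := grow_seq (y j)))"

text \<open>Two input letters decide the branch. Prefixes \<open>00\<close> and \<open>01\<close>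
  grow to three letters, \<open>10\<close> keeps two, \<open>11\<close> shrinks to one.\<close>

lemma grow_prefix_at:
  assumes j: "j \<in> idx d" and y: "y \<in> cube d"
  shows "prefix_at d (grow d j) y ((\<lambda>_. 0)(j := 2))
    ((\<lambda>_. 0)(j := if \<not> y j 0 then 3 else if \<not> y j 1 then 2 else 1))"
  unfolding prefix_at_def
proof (intro conjI ballI allI)
  show "fin_supp ((\<lambda>_. 0)(j := 2))" by (rule fin_supp_upd) simp
  show "fin_supp ((\<lambda>_. 0)(j := if \<not> y j 0 then 3 else if \<not> y j 1 then 2 else 1))"
    by (rule fin_supp_upd) simp
  fix z i k assume z: "z \<in> cyl d y ((\<lambda>_. 0)(j := 2))" and i: "i \<in> idx d"
  have zc: "z \<in> cube d" using z by (simp add: cyl_def)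
  have eq: "z j k = y j k" if "k < 2" for k using cylD[OF z j] that by simp
  have 01: "z j 0 = y j 0" "z j (Suc 0) = y j (Suc 0)" using eq[of 0] eq[of 1] by auto
  show "grow d j z i k =
      (if k < ((\<lambda>_. 0)(j := if \<not> y j 0 then 3 else if \<not> y j 1 then 2 else 1)) i then grow d j y i k
       else z i (k - ((\<lambda>_. 0)(j := if \<not> y j 0 then 3 else if \<not> y j 1 then 2 else 1)) i
         + ((\<lambda>_. 0)(j := 2)) i))"
  proof (cases "i = j")
    case False
    then show ?thesis using zc by (simp add: grow_def)
  next
    case True
    then show ?thesis using zc y 01
      by (cases k; cases "k - 1"; cases "k - 2") (auto simp: grow_def grow_seq_def)
  qed
qed

lemma grow_dV:
  assumes j: "j \<in> idx d"
  shows "grow d j \<in> dV d"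
proof (rule dV_I[where g = "\<lambda>y. y(j := ungrow_seq (y j))"])
  show "grow d j \<in> extensional (cube d)" by (simp add: grow_def)
  show "grow d j y \<in> cube d" "y(j := ungrow_seq (y j)) \<in> cube d" if "y \<in> cube d" for y
    using that j by (auto simp: grow_def cube_eq extensional_def)
  then show "grow d j (y(j := ungrow_seq (y j))) = y" if "y \<in> cube d" for y
    using that by (simp add: grow_def grow_ungrow_seq)
  show "(grow d j y)(j := ungrow_seq (grow d j y j)) = y" if "y \<in> cube d" for y
    using that by (simp add: grow_def ungrow_grow_seq)
  show "\<exists>p q. prefix_at d (grow d j) y p q" if "y \<in> cube d" for y
    using grow_prefix_at[OF j that] by blast
qed

text \<open>At the zero point the branch \<open>0z\<close> to \<open>00z\<close> applies, which
  lengthens coordinate \<open>j\<close> by one letter.\<close>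

lemma grow_has_shift:
  assumes j: "j \<in> idx d"
  shows "has_shift d (grow d j) (\<lambda>i\<in>idx d. \<lambda>k. False) (\<lambda>i. if i = j then 1 else 0)"
proof -
  let ?x = "\<lambda>i\<in>idx d. \<lambda>k::nat. False"
  have x: "?x \<in> cube d" by (simp add: cube_eq)
  have fx: "grow d j ?x = ?x" using j x by (auto simp: grow_def grow_seq_def fun_eq_iff split: nat.splits)
  show ?thesis
    unfolding has_shift_def
    by (intro conjI grow_dV[OF j] x fx exI, rule grow_prefix_at[OF j x]) (use j in auto)
qed

section \<open>Isomorphisms preserve germs\<close>

lemma integer_combination_closed:
  fixes R :: "((nat \<Rightarrow> int) \<times> (nat \<Rightarrow> int)) set"
  assumes zero: "(\<lambda>_. 0, \<lambda>_. 0) \<in> R"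
    and add: "\<And>v w v' w'. (v, w) \<in> R \<Longrightarrow> (v', w') \<in> R \<Longrightarrow> (\<lambda>i. v i + v' i, \<lambda>i. w i + w' i) \<in> R"
    and neg: "\<And>v w. (v, w) \<in> R \<Longrightarrow> (\<lambda>i. - v i, \<lambda>i. - w i) \<in> R"
    and J: "finite J" "\<And>j. j \<in> J \<Longrightarrow> (v j, w j) \<in> R"
  shows "(\<lambda>i. \<Sum>j\<in>J. k j * v j i, \<lambda>i. \<Sum>j\<in>J. k j * w j i) \<in> R"
  using J
proof (induction J rule: finite_induct)
  case (insert j J)
  \<comment> \<open>Nonnegative multiples arise by repeated addition, negative ones from these by
    closure under negation.\<close>
  have nat: "(\<lambda>i. int n * v j i, \<lambda>i. int n * w j i) \<in> R" for n
  proof (induction n)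
    case (Suc n)
    from add[OF Suc insert.prems[of j]] show ?case by (simp add: algebra_simps)
  qed (simp add: zero)
  have "(\<lambda>i. k j * v j i, \<lambda>i. k j * w j i) \<in> R"
  proof (cases "k j \<ge> 0")
    case True
    then show ?thesis using nat[of "nat (k j)"] by simp
  next
    case False
    then show ?thesis using neg[OF nat[of "nat (- k j)"]] by simp
  qed
  from add[OF this insert.IH] insert.prems insert.hyps show ?case by simp
qed (simp add: zero)

text \<open>Gaussian elimination without fractions, by induction on the number of
  coordinates.\<close>

lemma integer_relation:
  fixes v :: "'a \<Rightarrow> nat \<Rightarrow> int"
  assumes "finite J" "card J > M"
  shows "\<exists>k. (\<exists>j\<in>J. k j \<noteq> 0) \<and> (\<forall>i<M. (\<Sum>j\<in>J. k j * v j i) = 0)"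
  using assms
proof (induction M arbitrary: J v)
  case 0
  then obtain j where "j \<in> J" by fastforce
  then show ?case by (intro exI[of _ "\<lambda>_. 1"]) auto
next
  case (Suc M)
  show ?case
  proof (cases "\<forall>j\<in>J. v j M = 0")
    case True
    obtain k where "\<exists>j\<in>J. k j \<noteq> 0" "\<forall>i<M. (\<Sum>j\<in>J. k j * v j i) = 0"
      using Suc.IH[OF Suc.prems(1), of v] Suc.prems(2) by auto
    then show ?thesis using True by (intro exI[of _ k]) (auto simp: less_Suc_eq)
  next
    case False
    then obtain q where q: "q \<in> J" "v q M \<noteq> 0" by blast
    let ?J = "J - {q}"
    have J': "finite ?J" "card ?J > M" using Suc.prems q by auto
    \<comment> \<open>Cross-multiplication with the pivot \<open>q\<close> kills coordinate
      \<open>M\<close> without division.\<close>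
    define u where "u j i = v q M * v j i - v j M * v q i" for j i
    obtain k where k: "\<exists>j\<in>?J. k j \<noteq> 0" "\<forall>i<M. (\<Sum>j\<in>?J. k j * u j i) = 0"
      using Suc.IH[OF J', of u] by blast
    \<comment> \<open>This turns a relation among the \<open>u j\<close> into one among the
      \<open>v j\<close>: the coefficient of the pivot collects the terms
      \<open>- v j M * v q i\<close>.\<close>
    define k' where "k' j = (if j = q then - (\<Sum>j\<in>?J. k j * v j M) else v q M * k j)" for j
    have "(\<Sum>j\<in>J. k' j * v j i) = (\<Sum>j\<in>?J. k j * u j i)" for i
    proof -
      have "(\<Sum>j\<in>J. k' j * v j i) = k' q * v q i + (\<Sum>j\<in>?J. k' j * v j i)"
        using Suc.prems(1) q(1) by (rule sum.remove)
      also have "(\<Sum>j\<in>?J. k' j * v j i) = (\<Sum>j\<in>?J. v q M * k j * v j i)"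
        by (rule sum.cong) (auto simp: k'_def)
      also have "k' q * v q i = (\<Sum>j\<in>?J. - (k j * v j M * v q i))"
        by (simp add: k'_def sum_distrib_right sum_negf)
      also have "\<dots> + (\<Sum>j\<in>?J. v q M * k j * v j i) = (\<Sum>j\<in>?J. k j * u j i)"
        unfolding sum.distrib[symmetric] by (rule sum.cong) (auto simp: u_def algebra_simps)
      finally show ?thesis .
    qed
    moreover have "(\<Sum>j\<in>?J. k j * u j M) = 0" by (rule sum.neutral) (simp add: u_def)
    moreover have "\<exists>j\<in>J. k' j \<noteq> 0" using k(1) q(2) by (auto simp: k'_def)
    ultimately show ?thesis using k(2) by (intro exI[of _ k']) (auto simp: less_Suc_eq)
  qed
qed

section \<open>Transport of supports and the comparison of germs\<close>

lemma (in group) involution_conj: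
  assumes "involution G s" "h \<in> carrier G"
  shows "involution G (h \<otimes> s \<otimes> inv h)"
proof -
  have s: "s \<in> carrier G" "s \<noteq> \<one>" "s \<otimes> s = \<one>" using assms by (auto simp: involution_def)
  have "h \<otimes> s \<otimes> inv h \<otimes> (h \<otimes> s \<otimes> inv h) = h \<otimes> (s \<otimes> (inv h \<otimes> h) \<otimes> s) \<otimes> inv h"
    using s assms(2) by (simp only: m_assoc m_closed inv_closed)
  also have "\<dots> = \<one>" using s assms(2) by simp
  finally have "h \<otimes> s \<otimes> inv h \<otimes> (h \<otimes> s \<otimes> inv h) = \<one>" .
  moreover have "h \<otimes> s \<otimes> inv h \<noteq> \<one>"
  proof
    assume a: "h \<otimes> s \<otimes> inv h = \<one>"
    have "s = inv h \<otimes> (h \<otimes> s \<otimes> inv h) \<otimes> h" using s assms(2) by (simp add: m_assoc inv_solve_left)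
    then show False using a s assms(2) by simp
  qed
  ultimately show ?thesis using s assms(2) by (simp add: involution_def)
qed

text \<open>Inclusion is recovered from disjointness. A point of the first image support outside the
  second has a cylinder missing the second, which is closed. The flip of this cylinder pulls back to
  an involution disjoint from \<open>t\<close>, hence from \<open>r\<close>.\<close>

lemma iso_supp_subset:
  assumes d: "d \<ge> 1" and e: "e \<ge> 1" and \<phi>: "\<phi> \<in> iso (dV_group d) (dV_group e)"
    and r: "involution (dV_group d) r" and t: "involution (dV_group d) t"
    and sub: "supp d r \<subseteq> supp d t"
  shows "supp e (\<phi> r) \<subseteq> supp e (\<phi> t)"
proof
  have inv: "involution (dV_group e) (\<phi> s) \<longleftrightarrow> involution (dV_group d) s" if "s \<in> dV d" for s
    by (rule iso_involution[OF dV.is_group dV.is_group \<phi>]) (use that in simp)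
  have disj: "supp e (\<phi> s) \<inter> supp e (\<phi> s') = {} \<longleftrightarrow> supp d s \<inter> supp d s' = {}"
    if "involution (dV_group d) s" "involution (dV_group d) s'" for s s'
    using iso_alg_disjoint[OF dV.is_group dV.is_group \<phi>, of s s'] that involution_dV inv
    by (simp add: alg_disjoint_iff d e)
  have r': "involution (dV_group e) (\<phi> r)" and t': "involution (dV_group e) (\<phi> t)"
    using r t inv involution_dV by auto
  fix x assume x: "x \<in> supp e (\<phi> r)"
  then have xc: "x \<in> cube e" by (simp add: supp_def)
  show "x \<in> supp e (\<phi> t)"
  proof (rule ccontr)
    assume nx: "x \<notin> supp e (\<phi> t)"
    obtain p where p: "fin_supp p" "cyl e x p \<inter> supp e (\<phi> t) = {}"
      using involution_supp_closed[OF involution_dV[OF t'] involution_apply[OF t'] xc nx] by blast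
    define q' where "q' = flip e x p"
    have q': "involution (dV_group e) q'" "supp e q' = cyl e x p"
      unfolding q'_def using flip_involution[OF e p(1) xc] .
    obtain q where q: "q \<in> dV d" "q' = \<phi> q"
      using \<phi> involution_dV[OF q'(1)] by (auto simp: iso_def bij_betw_def)
    have qi: "involution (dV_group d) q" using inv[OF q(1)] q'(1) q(2) by simp
    have "supp d q \<inter> supp d t = {}" using disj[OF qi t] q' q p by simp
    then have "supp d q \<inter> supp d r = {}" using sub by blast
    then have "supp e q' \<inter> supp e (\<phi> r) = {}" using disj[OF qi r] q by simp
    then show False using x cyl_self[OF xc, of p] q'(2) by blast
  qed
qed

text \<open>Here \<open>m\<close> is finite even if \<open>n\<close> is infinite. The isomorphism
  goes from the larger dimension to the smaller, so \<open>M + 1\<close> independent shifts are sent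
  to shifts with only \<open>M\<close> coordinates.\<close>

lemma less_imp_not_iso:
  assumes m: "m \<ge> 1" and mn: "m < n" and \<psi>: "\<psi> \<in> iso (dV_group n) (dV_group m)"
  shows False
proof -
  obtain M where M: "m = enat M" using mn by (cases m) auto
  have n: "n \<ge> 1" using m mn by simp
  interpret \<psi>: group_hom "dV_group n" "dV_group m" \<psi>
    using \<psi> by (simp add: group_hom_def group_hom_axioms_def iso_def dV.is_group)
  have \<psi>V: "\<psi> a \<in> dV m" if "a \<in> dV n" for a using \<psi>.hom_closed[of a] that by simp
  have inj: "inj_on \<psi> (dV n)" and im: "\<psi> ` dV n = dV m"
    using \<psi> by (auto simp: iso_def bij_betw_def)
  have inv_iff: "involution (dV_group m) (\<psi> s) \<longleftrightarrow> involution (dV_group n) s" if "s \<in> dV n" for s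
    by (rule iso_involution[OF dV.is_group dV.is_group \<psi>]) (use that in simp)
  have \<psi>i: "involution (dV_group m) (\<psi> s)" if "involution (dV_group n) s" for s
    using that inv_iff[OF involution_dV[OF that]] by simp
  have disj: "supp m (\<psi> s) \<inter> supp m (\<psi> s') = {} \<longleftrightarrow> supp n s \<inter> supp n s' = {}"
    if "involution (dV_group n) s" "involution (dV_group n) s'" for s s'
    using iso_alg_disjoint[OF dV.is_group dV.is_group \<psi>, of s s'] that involution_dV \<psi>i
    by (simp add: alg_disjoint_iff m n)
  have sub: "supp m (\<psi> s) \<subseteq> supp m (\<psi> t)"
    if "involution (dV_group n) s" "involution (dV_group n) t" "supp n s \<subseteq> supp n t" for s t
    using iso_supp_subset[OF n m \<psi> that] .
  have flip_preimage: "\<exists>q. involution (dV_group n) q \<and> supp m (\<psi> q) = cyl m y p"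
    if py: "fin_supp p" "y \<in> cube m" for y p
  proof -
    obtain q where q: "q \<in> dV n" "\<psi> q = flip m y p"
      using im involution_dV[OF flip_involution(1)[OF m py]] by (metis imageE)
    then show ?thesis using flip_involution[OF m py] inv_iff[OF q(1)] by auto
  qed

  define x where "x = (\<lambda>i\<in>idx n. \<lambda>k::nat. False)"
  have x: "x \<in> cube n" by (simp add: x_def cube_eq)
  \<comment> \<open>If no \<open>y\<close> works, finitely many cylinders cover the cube, each
    missing the image support of some involution that moves \<open>x\<close>. A flip near
    \<open>x\<close>, supported inside all those supports, would then have empty image
    support.\<close>
  have "\<exists>y\<in>cube m. \<forall>t. involution (dV_group n) t \<longrightarrow> x \<in> supp n t \<longrightarrow> y \<in> supp m (\<psi> t)"
  proof (rule ccontr)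
    assume neg: "\<not> ?thesis"
    have "\<exists>t p. involution (dV_group n) t \<and> x \<in> supp n t \<and> fin_supp p \<and> cyl m y p \<inter> supp m (\<psi> t) = {}"
      if y: "y \<in> cube m" for y
    proof -
      obtain t where t: "involution (dV_group n) t" "x \<in> supp n t" "y \<notin> supp m (\<psi> t)"
        using neg y by blast
      obtain p where "fin_supp p" "cyl m y p \<inter> supp m (\<psi> t) = {}"
        using involution_supp_closed[OF \<psi>V[OF involution_dV[OF t(1)]] involution_apply[OF \<psi>i[OF t(1)]] y t(3)]
        by blast
      then show ?thesis using t by blast
    qed
    then obtain t p where tp: "\<And>y. y \<in> cube m \<Longrightarrow> involution (dV_group n) (t y)"
        "\<And>y. y \<in> cube m \<Longrightarrow> x \<in> supp n (t y)" "\<And>y. y \<in> cube m \<Longrightarrow> fin_supp (p y)"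
        "\<And>y. y \<in> cube m \<Longrightarrow> cyl m y (p y) \<inter> supp m (\<psi> (t y)) = {}" by metis
    obtain F where F: "finite F" "F \<subseteq> cube m" "cube m = (\<Union>y\<in>F. cyl m y (p y))"
      using finite_cyl_cover[of m p, OF tp(3)] by blast
    have "\<exists>r. fin_supp r \<and> (\<forall>y\<in>F. cyl n x r \<subseteq> supp n (t y))" using F(1,2)
    proof (induction F rule: finite_induct)
      case empty
      then show ?case by (intro exI[of _ "\<lambda>_. 0"]) simp
    next
      case (insert y F)
      then obtain r where r: "fin_supp r" "\<forall>y\<in>F. cyl n x r \<subseteq> supp n (t y)" by auto
      have y: "y \<in> cube m" using insert.prems by simp
      obtain r' where r': "fin_supp r'" "cyl n x r' \<subseteq> supp n (t y)"
        using supp_open[OF involution_dV[OF tp(1)[OF y]] tp(2)[OF y]] by blast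
      have "cyl n x (\<lambda>i. r i + r' i) \<subseteq> cyl n x r" "cyl n x (\<lambda>i. r i + r' i) \<subseteq> cyl n x r'"
        by (rule cyl_mono; simp)+
      then have "\<forall>z\<in>insert y F. cyl n x (\<lambda>i. r i + r' i) \<subseteq> supp n (t z)" using r(2) r'(2) by auto
      then show ?case using fin_supp_plus[OF r(1) r'(1)] by (intro exI[of _ "\<lambda>i. r i + r' i"] conjI)
    qed
    then obtain r where r: "fin_supp r" "\<And>y. y \<in> F \<Longrightarrow> cyl n x r \<subseteq> supp n (t y)" by blast
    define q where "q = flip n x r"
    have q: "involution (dV_group n) q" "supp n q = cyl n x r"
      unfolding q_def using flip_involution[OF n r(1) x] .
    obtain z where z: "z \<in> supp m (\<psi> q)" using involution_supp_nonempty[OF \<psi>i[OF q(1)]] by blast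
    then have "z \<in> cube m" by (simp add: supp_def)
    then obtain y where y: "y \<in> F" "z \<in> cyl m y (p y)" using F(3) by blast
    then have "y \<in> cube m" using F(2) by blast
    then have "z \<in> supp m (\<psi> (t y))"
      using sub[OF q(1) tp(1), of y] r(2)[OF y(1)] q(2) z by auto
    then show False using tp(4)[OF \<open>y \<in> cube m\<close>] y(2) by blast
  qed
  then obtain y where y: "y \<in> cube m"
    and xy: "\<And>t. involution (dV_group n) t \<Longrightarrow> x \<in> supp n t \<Longrightarrow> y \<in> supp m (\<psi> t)" by blast
  \<comment> \<open>If \<open>x\<close> were outside the closed support of \<open>t\<close>, a flip
    near \<open>x\<close> disjoint from \<open>t\<close> would have \<open>y\<close> in its image
    support, which is disjoint from that of \<open>t\<close>.\<close>
  have yx: "x \<in> supp n t" if t: "involution (dV_group n) t" "y \<in> supp m (\<psi> t)" for t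
  proof (rule ccontr)
    assume nx: "x \<notin> supp n t"
    obtain p where p: "fin_supp p" "cyl n x p \<inter> supp n t = {}"
      using involution_supp_closed[OF involution_dV[OF t(1)] involution_apply[OF t(1)] x nx] by blast
    define q where "q = flip n x p"
    have q: "involution (dV_group n) q" "supp n q = cyl n x p"
      unfolding q_def using flip_involution[OF n p(1) x] .
    have "y \<in> supp m (\<psi> q)" using xy[OF q(1)] q(2) cyl_self[OF x] by simp
    moreover have "supp m (\<psi> q) \<inter> supp m (\<psi> t) = {}" using disj[OF q(1) t(1)] q(2) p(2) by simp
    ultimately show False using t(2) by blast
  qed

  \<comment> \<open>Otherwise some \<open>q\<close> has as image support a cylinder at
    \<open>y\<close> displaced by \<open>\<psi> a\<close>. Conjugating \<open>q\<close> by
    \<open>a\<close> keeps \<open>x\<close> in the support, so \<open>y\<close> lies in the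
    displaced copy of the cylinder, which is impossible.\<close>
  have stab: "\<psi> a y = y" if a: "a \<in> dV n" "a x = x" for a
  proof (rule ccontr)
    assume "\<psi> a y \<noteq> y"
    then have "y \<in> supp m (\<psi> a)" using y by (simp add: supp_def)
    then obtain p where p: "fin_supp p" "\<And>z. z \<in> cyl m y p \<Longrightarrow> \<psi> a z \<notin> cyl m y p"
      using supp_displaced[OF \<psi>V[OF a(1)]] by blast
    obtain q where q: "involution (dV_group n) q" "supp m (\<psi> q) = cyl m y p"
      using flip_preimage[OF p(1) y] by blast
    have qV: "q \<in> dV n" using q(1) by (rule involution_dV)
    let ?c = "a \<otimes>\<^bsub>dV_group n\<^esub> q \<otimes>\<^bsub>dV_group n\<^esub> inv\<^bsub>dV_group n\<^esub> a"
    have c: "involution (dV_group n) ?c" using dV.involution_conj[OF q(1)] a(1) by simp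
    have "x \<in> supp n q" using yx[OF q(1)] q(2) cyl_self[OF y] by simp
    then have "x \<in> supp n ?c" using supp_conj[OF qV a(1)] a(2) by (metis imageI)
    then have "y \<in> supp m (\<psi> ?c)" by (rule xy[OF c])
    moreover have "\<psi> ?c = \<psi> a \<otimes>\<^bsub>dV_group m\<^esub> \<psi> q \<otimes>\<^bsub>dV_group m\<^esub> inv\<^bsub>dV_group m\<^esub> \<psi> a"
      using a(1) qV by simp
    ultimately have "y \<in> \<psi> a ` cyl m y p" using supp_conj[OF \<psi>V[OF qV] \<psi>V[OF a(1)]] q(2) by simp
    then show False using p(2) cyl_self[OF y] by blast
  qed

  \<comment> \<open>\<open>q\<close> transfers the neighbourhood of \<open>y\<close> to one of
    \<open>x\<close>. If \<open>a\<close> moved \<open>z\<close> there, take a flip \<open>r\<close>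
    on a cylinder at \<open>z\<close> displaced by \<open>a\<close>. Its image is supported where
    \<open>\<psi> a\<close> is trivial, so \<open>r\<close> commutes with \<open>a\<close>; but then
    \<open>r\<close> would fix \<open>z\<close>.\<close>
  have triv: "\<exists>p'. fin_supp p' \<and> (\<forall>z\<in>cyl n x p'. a z = z)"
    if a: "a \<in> dV n" and p: "fin_supp p" "\<And>z. z \<in> cyl m y p \<Longrightarrow> \<psi> a z = z" for a p
  proof -
    obtain q where q: "involution (dV_group n) q" "supp m (\<psi> q) = cyl m y p"
      using flip_preimage[OF p(1) y] by blast
    have "x \<in> supp n q" using yx[OF q(1)] q(2) cyl_self[OF y] by simp
    then obtain p' where p': "fin_supp p'" "cyl n x p' \<subseteq> supp n q"
      using supp_open[OF involution_dV[OF q(1)]] by blast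
    have "a z = z" if z: "z \<in> cyl n x p'" for z
    proof (rule ccontr)
      assume nz: "a z \<noteq> z"
      have zc: "z \<in> cube n" using z by (simp add: cyl_def)
      then have "z \<in> supp n a" using nz by (simp add: supp_def)
      then obtain p1 where p1: "fin_supp p1" "\<And>w. w \<in> cyl n z p1 \<Longrightarrow> a w \<notin> cyl n z p1"
        using supp_displaced[OF a] by blast
      have zq: "z \<in> supp n q" using z p'(2) by blast
      obtain p2 where p2: "fin_supp p2" "cyl n z p2 \<subseteq> supp n q"
        using supp_open[OF involution_dV[OF q(1)] zq] by blast
      let ?p = "\<lambda>i. p1 i + p2 i"
      have fp: "fin_supp ?p" by (rule fin_supp_plus[OF p1(1) p2(1)])
      have cs: "cyl n z ?p \<subseteq> cyl n z p1" "cyl n z ?p \<subseteq> cyl n z p2" by (rule cyl_mono; simp)+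
      define r where "r = flip n z ?p"
      have r: "involution (dV_group n) r" "supp n r = cyl n z ?p"
        unfolding r_def using flip_involution[OF n fp zc] .
      have rV: "r \<in> dV n" using r(1) by (rule involution_dV)
      have rs: "supp m (\<psi> r) \<subseteq> cyl m y p"
        using sub[OF r(1) q(1)] r(2) cs(2) p2(2) q(2) by blast
      have roff: "\<psi> r w = w" if "w \<in> cube m" "w \<notin> cyl m y p" for w
        using that rs by (auto simp: supp_def)
      have "\<psi> a (\<psi> r w) = \<psi> r (\<psi> a w)" if w: "w \<in> cube m" for w
      proof (cases "w \<in> cyl m y p")
        case True
        then have "\<psi> r w \<in> cyl m y p"
          by (rule maps_of_supp_subset[OF \<psi>V[OF rV] rs _ cyl_subset_cube])
        then show ?thesis using p(2) True by simp
      next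
        case False
        have "\<psi> a w \<notin> cyl m y p"
        proof
          assume b: "\<psi> a w \<in> cyl m y p"
          then have "\<psi> a (\<psi> a w) = \<psi> a w" by (rule p(2))
          then have "\<psi> a w = w" using dV_inj[OF \<psi>V[OF a]] w \<psi>V[OF a] by simp
          then show False using b False by simp
        qed
        then show ?thesis using roff False w \<psi>V[OF a] by simp
      qed
      then have "\<psi> a \<otimes>\<^bsub>dV_group m\<^esub> \<psi> r = \<psi> r \<otimes>\<^bsub>dV_group m\<^esub> \<psi> a"
        using \<psi>V[OF a] \<psi>V[OF rV] by (subst dV_eq_iff[of _ m]) auto
      then have "\<psi> (a \<otimes>\<^bsub>dV_group n\<^esub> r) = \<psi> (r \<otimes>\<^bsub>dV_group n\<^esub> a)" using a rV by simp
      then have "a \<otimes>\<^bsub>dV_group n\<^esub> r = r \<otimes>\<^bsub>dV_group n\<^esub> a"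
        using inj_onD[OF inj] a rV by simp
      then have "a (r z) = r (a z)"
        using dV_mult_apply[OF a rV zc] dV_mult_apply[OF rV a zc] by simp
      moreover have zp: "z \<in> cyl n z ?p" using zc by (rule cyl_self)
      then have "a z \<notin> cyl n z ?p" using p1(2)[of z] cs(1) by blast
      then have "r (a z) = a z" using r(2) a zc by (auto simp: supp_def)
      ultimately have "r z = z" using dV_inj[OF a] rV zc by simp
      then show False using zp r(2) by (auto simp: supp_def)
    qed
    then show ?thesis using p'(1) by blast
  qed

  \<comment> \<open>Pairs of shifts of one element at \<open>x\<close> and of its image at
    \<open>y\<close>. Closure under addition and negation lets a single element realise an integer
    combination on both sides at once.\<close>
  define R where "R = {(v, w). \<exists>a. has_shift n a x v \<and> has_shift m (\<psi> a) y w}"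
  have zero: "(\<lambda>_. 0, \<lambda>_. 0) \<in> R"
  proof -
    have "has_shift d \<one>\<^bsub>dV_group d\<^esub> z (\<lambda>_. 0)" if z: "z \<in> cube d" for d z
    proof -
      have "prefix_at d \<one>\<^bsub>dV_group d\<^esub> z (\<lambda>_. 0) (\<lambda>_. 0)"
        by (auto simp: prefix_at_def cyl_def)
      then show ?thesis using z unfolding has_shift_def by force
    qed
    from this[OF x] this[OF y] show ?thesis unfolding R_def using \<psi>.hom_one by auto
  qed
  have add: "(\<lambda>i. v i + v' i, \<lambda>i. w i + w' i) \<in> R" if vw: "(v, w) \<in> R" "(v', w') \<in> R" for v w v' w'
  proof -
    obtain a a' where a: "has_shift n a x v" "has_shift m (\<psi> a) y w"
      "has_shift n a' x v'" "has_shift m (\<psi> a') y w'" using vw unfolding R_def by blast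
    have "a \<in> dV n" "a' \<in> dV n" using a by (auto simp: has_shift_def)
    then have "\<psi> (a \<otimes>\<^bsub>dV_group n\<^esub> a') = \<psi> a \<otimes>\<^bsub>dV_group m\<^esub> \<psi> a'" by simp
    then show ?thesis
      using has_shift_mult[OF a(1,3)] has_shift_mult[OF a(2,4)] unfolding R_def
      by (auto intro!: exI[of _ "a \<otimes>\<^bsub>dV_group n\<^esub> a'"])
  qed
  have neg: "(\<lambda>i. - v i, \<lambda>i. - w i) \<in> R" if vw: "(v, w) \<in> R" for v w
  proof -
    obtain a where a: "has_shift n a x v" "has_shift m (\<psi> a) y w" using vw unfolding R_def by blast
    have "a \<in> dV n" using a by (auto simp: has_shift_def)
    then have "\<psi> (inv\<^bsub>dV_group n\<^esub> a) = inv\<^bsub>dV_group m\<^esub> \<psi> a" by simp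
    then show ?thesis
      using has_shift_inv[OF a(1)] has_shift_inv[OF a(2)] unfolding R_def
      by (auto intro!: exI[of _ "inv\<^bsub>dV_group n\<^esub> a"])
  qed
  have idx: "j \<in> idx n" if "j \<le> M" for j
  proof -
    have "enat j \<le> m" using that M by simp
    then show ?thesis using mn unfolding idx_def by (simp add: le_less_trans)
  qed
  have "\<exists>w. (\<lambda>i. if i = j then 1 else 0, w) \<in> R" if "j \<le> M" for j
  proof -
    have s: "has_shift n (grow n j) x (\<lambda>i. if i = j then 1 else 0)"
      unfolding x_def using grow_has_shift[OF idx[OF that]] .
    then have g: "grow n j \<in> dV n" "grow n j x = x" by (auto simp: has_shift_def)
    show ?thesis using has_shift_ex[OF \<psi>V[OF g(1)] y stab[OF g]] s unfolding R_def by blast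
  qed
  then obtain w where w: "\<And>j. j \<in> {..M} \<Longrightarrow> (\<lambda>i. if i = j then 1 else 0, w j) \<in> R" by (metis atMost_iff)
  \<comment> \<open>There are \<open>M + 1\<close> vectors \<open>w j\<close>, but only the
    \<open>M\<close> coordinates in \<open>idx m\<close> have to cancel.\<close>
  obtain k where k: "\<exists>j\<in>{..M}. k j \<noteq> 0" "\<forall>i<M. (\<Sum>j\<in>{..M}. k j * w j i) = 0"
    using integer_relation[of "{..M}" M w] by auto
  have "(\<lambda>i. \<Sum>j\<in>{..M}. k j * (if i = j then 1 else 0), \<lambda>i. \<Sum>j\<in>{..M}. k j * w j i) \<in> R"
    by (rule integer_combination_closed[OF zero add neg finite_atMost w])
  then obtain a where a: "has_shift n a x (\<lambda>i. \<Sum>j\<in>{..M}. k j * (if i = j then 1 else 0))"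
    "has_shift m (\<psi> a) y (\<lambda>i. \<Sum>j\<in>{..M}. k j * w j i)" unfolding R_def by blast
  have "(\<Sum>j\<in>{..M}. k j * w j i) = 0" if "i \<in> idx m" for i
    using that k(2) M by (simp add: idx_def)
  from has_shift_zero_trivial[OF a(2) this] obtain p
    where p: "fin_supp p" "\<And>z. z \<in> cyl m y p \<Longrightarrow> \<psi> a z = z" by blast
  have aV: "a \<in> dV n" using a(1) by (simp add: has_shift_def)
  obtain p' where p': "fin_supp p'" "\<And>z. z \<in> cyl n x p' \<Longrightarrow> a z = z"
    using triv[OF aV p] by blast
  \<comment> \<open>By the choice of unit vectors the shift of \<open>a\<close> at \<open>x\<close>
    has entry \<open>k i\<close> at each \<open>i \<le> M\<close>, and it vanishes because
    \<open>a\<close> is trivial near \<open>x\<close>.\<close>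
  have "k i = 0" if "i \<le> M" for i
  proof -
    have "(\<Sum>j\<in>{..M}. k j * (if i = j then 1 else 0)) = 0"
      by (rule trivial_has_shift_zero[OF a(1) p' idx[OF that]])
    moreover have "(\<Sum>j\<in>{..M}. k j * (if i = j then 1 else 0)) = (\<Sum>j\<in>{..M}. if i = j then k j else 0)"
      by (rule sum.cong) auto
    ultimately show ?thesis using that by simp
  qed
  then show False using k(1) by auto
qed

theorem theorem1:
  fixes m n :: enat
  assumes "m \<ge> 1" and "n \<ge> 1" and "m \<noteq> n"
  shows "\<not> (dV_group m \<cong> dV_group n)"
proof
  assume iso: "dV_group m \<cong> dV_group n"
  have "dV_group n \<cong> dV_group m" using iso by (rule dV.iso_sym)
  then obtain \<phi> \<psi> where "\<phi> \<in> iso (dV_group m) (dV_group n)" "\<psi> \<in> iso (dV_group n) (dV_group m)"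
    using iso unfolding is_iso_def by blast
  moreover have "m < n \<or> n < m" using assms(3) by auto
  ultimately show False using less_imp_not_iso assms(1,2) by blast
qed

end
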